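(* Let $\psi:\mathrm{Up}_n(\mathbb{C})\to\mathrm{Sym}_n(\mathbb{C})$ be the map $U\mapsto U^{T}U$. Then for every $w\in S_n$, $$\overline{\psi(V_{\rm up}(w))}=V_{\rm sym}(w),$$ where the bar denotes Zariski closure.
   Context: $\mathrm{Up}_n(\mathbb{C})$ and $\mathrm{Sym}_n(\mathbb{C})$ are the spaces of upper triangular and of symmetric $n\times n$ complex matrices. $\Sigma=(\sigma_{ij})$ (with $\sigma_{ij}=\sigma_{ji}$) and $Y=(y_{ij})$ (with $y_{ij}=0$ for $i>j$) are a symmetric and an upper triangular $n\times n$ matrix of indeterminates. For $w\in S_n$, $P(w)$ is the $n\times n$ permutation matrix with a $1$ in position $(i,j)$ iff $n+1-w(i)=j$, and $R(w)_{ij}=\sum_{k=1}^{i}\sum_{l=j}^{n}P(w)_{kl}$. Set $$J_{\rm sym}(w)=\sum_{i,j}\langle (R(w)_{ij}+1)\text{-minors of }\Sigma_{[1,i],[j,n]}\rangle\subseteq\mathbb{C}[\Sigma],\qquad J_{\rm up}(w)=\sum_{i,j}\langle (R(w)_{ij}+1)\text{-minors of }Y_{[1,i],[j,n]}\rangle\subseteq\mathbb{C}[Y],$$ sums over $1\le i,j\le n$, where $M_{[1,i],[j,n]}$ is the submatrix of $M$ on rows $1,\dots,i$ and columns $j,\dots,n$, and minors larger than the matrix contribute the zero ideal. $V_{\rm sym}(w)\subseteq\mathrm{Sym}_n(\mathbb{C})$ and $V_{\rm up}(w)\subseteq\mathrm{Up}_n(\mathbb{C})$ are the vanishing sets of $J_{\rm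 sym}(w)$ and $J_{\rm up}(w)$. *)

theory Defs
  imports
    Complex_Main
    "HOL-Library.Poly_Mapping"
    "HOL-Library.Set_Algebras"
    "Jordan_Normal_Form.Determinant"
    "Jordan_Normal_Form.DL_Submatrix"
begin

text \<open>
  Matrix entries and indeterminates are indexed from 0, as in the matrix library.  The
  permutation w and the row and column bounds i, j of the corner submatrices are indexed
  from 1, as in the literature; shifts by one mark the translation.
\<close>

type_synonym mpoly = "((nat \<times> nat) \<Rightarrow>\<^sub>0 nat) \<Rightarrow>\<^sub>0 complex"

definition Indet :: "nat \<times> nat \<Rightarrow> mpoly" where
  "Indet x = Poly_Mapping.single (Poly_Mapping.single x 1) 1"

text \<open>
  The polynomial ring in the indeterminates with index in the upper triangle.  It serves
  both as the coordinate ring of symmetric matrices and as that of upper triangular matrices.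
\<close>

definition poly_ring :: "nat \<Rightarrow> mpoly set" where
  "poly_ring n = {p. \<forall>m \<in> Poly_Mapping.keys p. Poly_Mapping.keys m \<subseteq> {(i, j). i \<le> j \<and> j < n}}"

definition eval_at :: "complex mat \<Rightarrow> mpoly \<Rightarrow> complex" where
  "eval_at A p = (\<Sum>m \<in> Poly_Mapping.keys p. Poly_Mapping.lookup p m *
     (\<Prod>x \<in> Poly_Mapping.keys m. (A $$ x) ^ Poly_Mapping.lookup m x))"

definition ideal_gen :: "nat \<Rightarrow> mpoly set \<Rightarrow> mpoly set" where
  "ideal_gen n G =
     {\<Sum>g\<in>F. c g * g | F c. finite F \<and> F \<subseteq> G \<and> (\<forall>g\<in>F. c g \<in> poly_ring n)}"

definition Sym :: "nat \<Rightarrow> complex mat set" where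
  "Sym n = {A \<in> carrier_mat n n. transpose_mat A = A}"

definition Up :: "nat \<Rightarrow> complex mat set" where
  "Up n = {A \<in> carrier_mat n n. upper_triangular A}"

definition vanishing_set :: "complex mat set \<Rightarrow> mpoly set \<Rightarrow> complex mat set" where
  "vanishing_set X F = {A \<in> X. \<forall>p\<in>F. eval_at A p = 0}"

text \<open>
  The Zariski closed subsets of the affine space \<open>Sym n\<close>.  The Zariski closure of a subset S
  is \<open>zariski_closed n hull S\<close>, the intersection of all closed sets containing S.
\<close>

definition zariski_closed :: "nat \<Rightarrow> complex mat set \<Rightarrow> bool" where
  "zariski_closed n Z \<longleftrightarrow> (\<exists>F \<subseteq> poly_ring n. Z = vanishing_set (Sym n) F)"

definition Sigma_mat :: "nat \<Rightarrow> mpoly mat" where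
  "Sigma_mat n = mat n n (\<lambda>(i, j). Indet (min i j, max i j))"

definition Y_mat :: "nat \<Rightarrow> mpoly mat" where
  "Y_mat n = mat n n (\<lambda>(i, j). if i \<le> j then Indet (i, j) else 0)"

definition perm_mat :: "nat \<Rightarrow> (nat \<Rightarrow> nat) \<Rightarrow> nat mat" where
  "perm_mat n w = mat n n (\<lambda>(i, j). if n + 1 - w (i + 1) = j + 1 then 1 else 0)"

definition corner_rank :: "nat \<Rightarrow> (nat \<Rightarrow> nat) \<Rightarrow> nat \<Rightarrow> nat \<Rightarrow> nat" where
  "corner_rank n w i j = (\<Sum>k = 1..i. \<Sum>l = j..n. perm_mat n w $$ (k - 1, l - 1))"

definition corner :: "nat \<Rightarrow> 'a mat \<Rightarrow> nat \<Rightarrow> nat \<Rightarrow> 'a mat" where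
  "corner n M i j = submatrix M {0..<i} {j - 1..<n}"

text \<open>There are no r-minors when r exceeds a dimension of the matrix.\<close>

definition minors :: "nat \<Rightarrow> 'a :: comm_ring_1 mat \<Rightarrow> 'a set" where
  "minors r A = {det (submatrix A I J) | I J.
     I \<subseteq> {..<dim_row A} \<and> J \<subseteq> {..<dim_col A} \<and> card I = r \<and> card J = r}"

text \<open>The sum is the elementwise sum of sets, i.e. the sum of ideals.\<close>

definition rank_ideal :: "nat \<Rightarrow> (nat \<Rightarrow> nat) \<Rightarrow> mpoly mat \<Rightarrow> mpoly set" where
  "rank_ideal n w M =
     (\<Sum>i = 1..n. \<Sum>j = 1..n. ideal_gen n (minors (corner_rank n w i j + 1) (corner n M i j)))"

definition J_sym :: "nat \<Rightarrow> (nat \<Rightarrow> nat) \<Rightarrow> mpoly set" where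
  "J_sym n w = rank_ideal n w (Sigma_mat n)"

definition J_up :: "nat \<Rightarrow> (nat \<Rightarrow> nat) \<Rightarrow> mpoly set" where
  "J_up n w = rank_ideal n w (Y_mat n)"

definition V_sym :: "nat \<Rightarrow> (nat \<Rightarrow> nat) \<Rightarrow> complex mat set" where
  "V_sym n w = vanishing_set (Sym n) (J_sym n w)"

definition V_up :: "nat \<Rightarrow> (nat \<Rightarrow> nat) \<Rightarrow> complex mat set" where
  "V_up n w = vanishing_set (Up n) (J_up n w)"

definition psi :: "complex mat \<Rightarrow> complex mat" where
  "psi U = transpose_mat U * U"

end

theory Submission
  imports Defs
begin

text \<open>
  If \<open>U\<close> is upper triangular, the first \<open>i\<close> rows of \<open>U\<^sup>TU\<close> are combinations of the first \<open>i\<close> rows of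
  \<open>U\<close>, so \<open>psi\<close> maps \<open>V_up\<close> into \<open>V_sym\<close>.  Conversely, every \<open>S\<close> in \<open>V_sym\<close> is a limit of points
  \<open>psi U\<close> in the Euclidean topology.  A greedy choice of columns gives an invertible \<open>Q\<close> that itself
  satisfies the rank conditions and for which \<open>L = S Q\<^sup>-\<^sup>1\<close> is lower triangular.  The pair \<open>(L, Q\<^sup>-\<^sup>1)\<close>
  spans a Lagrangian subspace, because \<open>S\<close> is symmetric, and it is a limit of Lagrangian pairs
  \<open>(L', N')\<close> with \<open>L'\<close> lower triangular and invertible.  The symmetric matrix \<open>N' L'\<^sup>-\<^sup>1\<close> can be
  perturbed to \<open>W\<^sup>TW\<close> with \<open>W\<close> lower triangular and invertible.  Since \<open>N' Q\<close> is close to the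
  identity, \<open>N' Q T\<close> is upper triangular for some lower triangular \<open>T\<close> close to the identity.  Then
  \<open>U = W L' Q T\<close> is upper triangular, it inherits the rank conditions of \<open>Q\<close> since its outer factors
  are lower triangular, and \<open>U\<^sup>TU = T\<^sup>T (L' Q)\<^sup>T (N' Q) T\<close> is close to \<open>S\<close>.
\<close>

section \<open>Triangular matrices and entrywise limits\<close>

text \<open>Suppose \<open>L\<close> is invertible and \<open>W^T W = P L^-1\<close> with
  \<open>P = Q^-1\<close>. Then \<open>U = W L Q\<close> satisfies \<open>W^T U = P Q = 1\<close>,
  so \<open>U\<close> is upper triangular, and \<open>U^T U = (L Q)^T P Q = S\<close>. The obstacle
  is a singular \<open>L\<close>, for which \<open>P L^-1\<close> does not exist. Moving
  \<open>L\<close> alone would in general destroy the symmetry that \<open>P L^-1\<close> must have;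
  the Lagrangian condition expresses this symmetry without an inverse, so that \<open>L\<close> and
  \<open>P\<close> can be moved together. The price is that the moved \<open>P\<close> is no longer
  inverse to \<open>Q\<close>, which is what the correction \<open>T\<close> repairs.
  \<open>Q\<close> itself stays fixed, since it carries the rank conditions. Multiplying by a lower
  triangular matrix on the left combines the first \<open>a\<close> rows among themselves, and on
  the right it combines the columns from \<open>b\<close> on among themselves; neither raises the
  rank of a top right corner. This dictates that every factor around \<open>Q\<close>, and every
  perturbation of \<open>L\<close>, be lower triangular. Euclidean limits suffice for the Zariski
  closure because polynomials are continuous.\<close>

definition lower_tri :: "nat \<Rightarrow> complex mat \<Rightarrow> bool" where
  "lower_tri n A \<longleftrightarrow> A \<in> carrier_mat n n \<and> (\<forall>i<n. \<forall>j<n. i < j \<longrightarrow> A $$ (i, j) = 0)"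

definition inv_lower :: "nat \<Rightarrow> complex mat \<Rightarrow> bool" where
  "inv_lower n A \<longleftrightarrow> lower_tri n A \<and> (\<forall>i<n. A $$ (i, i) \<noteq> 0)"

lemma lower_triD:
  assumes "lower_tri n A"
  shows "A \<in> carrier_mat n n" "i < j \<Longrightarrow> j < n \<Longrightarrow> A $$ (i, j) = 0"
  using assms by (auto simp: lower_tri_def)

lemma inv_lowerD:
  assumes "inv_lower n A"
  shows "A \<in> carrier_mat n n" "lower_tri n A" "i < n \<Longrightarrow> A $$ (i, i) \<noteq> 0"
  using assms by (auto simp: inv_lower_def lower_tri_def)

lemma mult_entry:
  assumes "A \<in> carrier_mat n n" "B \<in> carrier_mat n n" "i < n" "j < n"
  shows "(A * B) $$ (i, j) = (\<Sum>l<n. A $$ (i, l) * B $$ (l, j))"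
  using assms by (auto simp: scalar_prod_def lessThan_atLeast0 intro!: sum.cong)

lemma lower_tri_mult:
  assumes A: "lower_tri n A" and B: "lower_tri n B"
  shows "lower_tri n (A * B)"
proof -
  have "(A * B) $$ (i, j) = 0" if "i < j" "j < n" for i j
  proof -
    have "A $$ (i, l) * B $$ (l, j) = 0" if "l < n" for l
      using lower_triD(2)[OF A, of i l] lower_triD(2)[OF B, of l j] that \<open>i < j\<close> \<open>j < n\<close>
      by (cases "i < l") auto
    then show ?thesis
      using that lower_triD(1)[OF A] lower_triD(1)[OF B]
      by (simp add: mult_entry[where n = n] sum.neutral del: index_mult_mat mult_eq_0_iff)
  qed
  then show ?thesis
    using lower_triD(1)[OF A] lower_triD(1)[OF B] by (simp add: lower_tri_def del: index_mult_mat)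
qed

lemma lower_tri_mult_diag:
  assumes A: "lower_tri n A" and B: "lower_tri n B" and i: "i < n"
  shows "(A * B) $$ (i, i) = A $$ (i, i) * B $$ (i, i)"
proof -
  have "A $$ (i, l) * B $$ (l, i) = (if l = i then A $$ (i, i) * B $$ (i, i) else 0)" if "l < n" for l
    using lower_triD(2)[OF A, of i l] lower_triD(2)[OF B, of l i] that i
    by (cases i l rule: linorder_cases) auto
  then have "(\<Sum>l<n. A $$ (i, l) * B $$ (l, i)) = (\<Sum>l<n. if l = i then A $$ (i, i) * B $$ (i, i) else 0)"
    by (intro sum.cong) auto
  then show ?thesis
    using i lower_triD(1)[OF A] lower_triD(1)[OF B] by (simp add: mult_entry del: index_mult_mat)
qed

lemma inv_lower_mult:
  assumes "inv_lower n A" "inv_lower n B"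
  shows "inv_lower n (A * B)"
proof -
  have "(A * B) $$ (i, i) \<noteq> 0" if "i < n" for i
    using lower_tri_mult_diag[of n A B i] assms that by (simp add: inv_lower_def del: index_mult_mat)
  then show ?thesis
    using assms by (simp add: inv_lower_def lower_tri_mult)
qed

text \<open>Back substitution in each row of \<open>X\<close>, from the last column leftwards: once
  the entries right of column \<open>j\<close> vanish, the \<open>(i, j)\<close> entry of
  \<open>X * B\<close> is \<open>X $$ (i, j) * B $$ (j, j)\<close>.\<close>

lemma lower_tri_cancel_right:
  assumes X: "X \<in> carrier_mat n n" and B: "inv_lower n B" and XB: "lower_tri n (X * B)"
  shows "lower_tri n X"
proof -
  have "X $$ (i, j) = 0" if i: "i < n" and "i < j" "j < n" for i j
    using that(2,3)
  proof (induction "n - j" arbitrary: j rule: less_induct)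
    case less
    have "X $$ (i, l) * B $$ (l, j) = (if l = j then X $$ (i, j) * B $$ (j, j) else 0)" if "l < n" for l
      using lower_triD(2)[OF inv_lowerD(2)[OF B], of l j] less.hyps[of l] less.prems that
      by (cases l j rule: linorder_cases) auto
    then have "(\<Sum>l<n. X $$ (i, l) * B $$ (l, j))
        = (\<Sum>l<n. if l = j then X $$ (i, j) * B $$ (j, j) else 0)"
      by (intro sum.cong) auto
    then have "(X * B) $$ (i, j) = X $$ (i, j) * B $$ (j, j)"
      using i less.prems X inv_lowerD(1)[OF B] by (simp add: mult_entry del: index_mult_mat)
    moreover have "(X * B) $$ (i, j) = 0"
      using lower_triD(2)[OF XB] less.prems by blast
    ultimately show ?case
      using inv_lowerD(3)[OF B, of j] less.prems by simp
  qed
  then show ?thesis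
    using X by (simp add: lower_tri_def)
qed

text \<open>The inverse is lower triangular because \<open>B\<close> can be cancelled from
  \<open>C * B\<close>, which is the identity.\<close>

lemma inv_lower_inverse:
  assumes B: "inv_lower n B"
  obtains C where "lower_tri n C" "B * C = 1\<^sub>m n" "C * B = 1\<^sub>m n"
proof -
  have Bc: "B \<in> carrier_mat n n"
    using inv_lowerD(1)[OF B] .
  have "det B = prod_list (diag_mat B)"
    using det_lower_triangular[of n B] lower_triD(2)[OF inv_lowerD(2)[OF B]] Bc by blast
  also have "\<dots> \<noteq> 0"
    using inv_lowerD(3)[OF B] Bc by (auto simp: prod_list_zero_iff diag_mat_def)
  finally have "det B \<noteq> 0" .
  then have "B \<in> Units (ring_mat TYPE(complex) n ())"
    by (rule det_non_zero_imp_unit[OF Bc])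
  then obtain C where C: "C \<in> carrier_mat n n" "C * B = 1\<^sub>m n" "B * C = 1\<^sub>m n"
    by (auto simp: Units_def ring_mat_def)
  have "lower_tri n (C * B)"
    unfolding C(2) by (simp add: lower_tri_def)
  then show thesis
    using that lower_tri_cancel_right[OF C(1) B] C by blast
qed

section \<open>Limits of matrices and of pairs of matrices\<close>

definition entry_lim :: "nat \<Rightarrow> (nat \<Rightarrow> complex mat) \<Rightarrow> complex mat \<Rightarrow> bool" where
  "entry_lim n X A \<longleftrightarrow> (\<forall>i<n. \<forall>j<n. (\<lambda>m. X m $$ (i, j)) \<longlonglongrightarrow> A $$ (i, j))"

lemma entry_limD: "entry_lim n X A \<Longrightarrow> i < n \<Longrightarrow> j < n \<Longrightarrow> (\<lambda>m. X m $$ (i, j)) \<longlonglongrightarrow> A $$ (i, j)"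
  by (simp add: entry_lim_def)

lemma entry_lim_const: "entry_lim n (\<lambda>m. A) A"
  by (simp add: entry_lim_def)

lemma entry_lim_mult:
  assumes "entry_lim n X A" "entry_lim n Y B"
    and "\<And>m. X m \<in> carrier_mat n n" "\<And>m. Y m \<in> carrier_mat n n"
    and "A \<in> carrier_mat n n" "B \<in> carrier_mat n n"
  shows "entry_lim n (\<lambda>m. X m * Y m) (A * B)"
  unfolding entry_lim_def
proof (intro allI impI)
  fix i j assume "i < n" "j < n"
  then show "(\<lambda>m. (X m * Y m) $$ (i, j)) \<longlonglongrightarrow> (A * B) $$ (i, j)"
    using assms(3-6) by (simp add: mult_entry[where n = n] del: index_mult_mat)
      (intro tendsto_sum tendsto_mult entry_limD[OF assms(1)] entry_limD[OF assms(2)]; simp)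
qed

lemma entry_lim_add:
  assumes "entry_lim n X A" "entry_lim n Y B"
    and "\<And>m. Y m \<in> carrier_mat n n" "B \<in> carrier_mat n n"
  shows "entry_lim n (\<lambda>m. X m + Y m) (A + B)"
  using assms by (auto simp: entry_lim_def carrier_matD[where nr = n and nc = n] intro!: tendsto_add)

lemma entry_lim_transpose:
  assumes "entry_lim n X A" "\<And>m. X m \<in> carrier_mat n n" "A \<in> carrier_mat n n"
  shows "entry_lim n (\<lambda>m. transpose_mat (X m)) (transpose_mat A)"
  using assms by (auto simp: entry_lim_def carrier_matD[where nr = n and nc = n])

text \<open>Pairs, because the two blocks of a Lagrangian pair must be perturbed together; a single
  symmetric matrix is treated by putting the identity in the first component.\<close>

definition seq_closure :: "nat \<Rightarrow> (complex mat \<times> complex mat) set \<Rightarrow> (complex mat \<times> complex mat) set" where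
  "seq_closure n S = {(A, B). \<exists>X Y. (\<forall>m. (X m, Y m) \<in> S) \<and> entry_lim n X A \<and> entry_lim n Y B}"

lemma seq_closureI:
  "(\<And>m. (X m, Y m) \<in> S) \<Longrightarrow> entry_lim n X A \<Longrightarrow> entry_lim n Y B \<Longrightarrow> (A, B) \<in> seq_closure n S"
  by (auto simp: seq_closure_def)

lemma seq_closureE:
  assumes "(A, B) \<in> seq_closure n S"
  obtains X Y where "\<And>m. (X m, Y m) \<in> S" "entry_lim n X A" "entry_lim n Y B"
  using assms by (auto simp: seq_closure_def)

lemma seq_closure_subset: "(A, B) \<in> S \<Longrightarrow> (A, B) \<in> seq_closure n S"
  by (rule seq_closureI[where X = "\<lambda>m. A" and Y = "\<lambda>m. B"]) (auto intro: entry_lim_const)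

lemma entry_lim_eventually:
  assumes "entry_lim n X A" "e > 0"
  shows "\<forall>\<^sub>F m in sequentially. \<forall>i<n. \<forall>j<n. dist (X m $$ (i, j)) (A $$ (i, j)) < e"
proof -
  have "\<forall>\<^sub>F m in sequentially. \<forall>i\<in>{..<n}. \<forall>j\<in>{..<n}. dist (X m $$ (i, j)) (A $$ (i, j)) < e"
    using assms by (intro eventually_ball_finite ballI) (auto intro!: tendstoD entry_limD)
  then show ?thesis
    by (simp add: lessThan_def)
qed

text \<open>In this form a limit of limits is handled by the triangle inequality, without a diagonal
  sequence.\<close>

lemma seq_closure_iff:
  "(A, B) \<in> seq_closure n S \<longleftrightarrow> (\<forall>e>0. \<exists>(X, Y)\<in>S. \<forall>i<n. \<forall>j<n.
     dist (X $$ (i, j)) (A $$ (i, j)) < e \<and> dist (Y $$ (i, j)) (B $$ (i, j)) < e)"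
  (is "_ \<longleftrightarrow> (\<forall>e>0. ?R e)")
proof
  assume "(A, B) \<in> seq_closure n S"
  then obtain X Y where XY: "\<And>m. (X m, Y m) \<in> S" "entry_lim n X A" "entry_lim n Y B"
    by (rule seq_closureE) blast
  show "\<forall>e>0. ?R e"
  proof (intro allI impI)
    fix e :: real assume "e > 0"
    with XY(2,3) have "\<forall>\<^sub>F m in sequentially. (\<forall>i<n. \<forall>j<n. dist (X m $$ (i, j)) (A $$ (i, j)) < e)
        \<and> (\<forall>i<n. \<forall>j<n. dist (Y m $$ (i, j)) (B $$ (i, j)) < e)"
      by (intro eventually_conj entry_lim_eventually)
    then obtain m where "(\<forall>i<n. \<forall>j<n. dist (X m $$ (i, j)) (A $$ (i, j)) < e)
        \<and> (\<forall>i<n. \<forall>j<n. dist (Y m $$ (i, j)) (B $$ (i, j)) < e)"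
      using eventually_happens'[OF sequentially_bot] by blast
    then show "?R e"
      using XY(1)[of m] by blast
  qed
next
  assume "\<forall>e>0. ?R e"
  then have "\<forall>m. ?R (inverse (real (Suc m)))"
    by simp
  then have "\<forall>m. \<exists>Z. Z \<in> S \<and> (\<forall>i<n. \<forall>j<n. dist (fst Z $$ (i, j)) (A $$ (i, j)) < inverse (real (Suc m))
      \<and> dist (snd Z $$ (i, j)) (B $$ (i, j)) < inverse (real (Suc m)))"
    by (simp add: Bex_def split_beta)
  then obtain Z where Z: "\<And>m. Z m \<in> S"
      "\<And>m i j. i < n \<Longrightarrow> j < n \<Longrightarrow> dist (fst (Z m) $$ (i, j)) (A $$ (i, j)) < inverse (real (Suc m))"
      "\<And>m i j. i < n \<Longrightarrow> j < n \<Longrightarrow> dist (snd (Z m) $$ (i, j)) (B $$ (i, j)) < inverse (real (Suc m))"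
    by metis
  have lim: "f \<longlonglongrightarrow> c" if "\<And>m. dist (f m) c < inverse (real (Suc m))" for f :: "nat \<Rightarrow> complex" and c
    by (rule metric_tendsto_imp_tendsto[OF LIMSEQ_inverse_real_of_nat always_eventually])
      (use that in \<open>simp add: less_imp_le\<close>)
  show "(A, B) \<in> seq_closure n S"
  proof (rule seq_closureI)
    show "(fst (Z m), snd (Z m)) \<in> S" for m
      using Z(1) by simp
    show "entry_lim n (\<lambda>m. fst (Z m)) A" "entry_lim n (\<lambda>m. snd (Z m)) B"
      unfolding entry_lim_def using Z(2,3) by (blast intro: lim)+
  qed
qed

text \<open>Lets perturbations be chained: half of \<open>e\<close> is spent on reaching
  \<open>(X m, Y m)\<close>, half on reaching a point of \<open>S\<close> from there.\<close>

lemma seq_closure_trans: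
  assumes "\<And>m. (X m, Y m) \<in> seq_closure n S" "entry_lim n X A" "entry_lim n Y B"
  shows "(A, B) \<in> seq_closure n S"
  unfolding seq_closure_iff
proof (intro allI impI)
  fix e :: real assume "e > 0"
  then have "\<forall>\<^sub>F m in sequentially. (\<forall>i<n. \<forall>j<n. dist (X m $$ (i, j)) (A $$ (i, j)) < e / 2)
      \<and> (\<forall>i<n. \<forall>j<n. dist (Y m $$ (i, j)) (B $$ (i, j)) < e / 2)"
    using assms(2,3) by (intro eventually_conj entry_lim_eventually) auto
  then obtain m where m: "\<forall>i<n. \<forall>j<n. dist (X m $$ (i, j)) (A $$ (i, j)) < e / 2"
      "\<forall>i<n. \<forall>j<n. dist (Y m $$ (i, j)) (B $$ (i, j)) < e / 2"
    using eventually_happens'[OF sequentially_bot] by blast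
  obtain P Q where PQ: "(P, Q) \<in> S"
      "\<forall>i<n. \<forall>j<n. dist (P $$ (i, j)) (X m $$ (i, j)) < e / 2 \<and> dist (Q $$ (i, j)) (Y m $$ (i, j)) < e / 2"
    using assms(1)[of m] \<open>e > 0\<close> unfolding seq_closure_iff by (blast dest: half_gt_zero)
  have "dist (P $$ (i, j)) (A $$ (i, j)) < e" "dist (Q $$ (i, j)) (B $$ (i, j)) < e" if "i < n" "j < n" for i j
    using PQ(2) m that dist_triangle[of "P $$ (i, j)" "A $$ (i, j)" "X m $$ (i, j)"]
      dist_triangle[of "Q $$ (i, j)" "B $$ (i, j)" "Y m $$ (i, j)"]
    by (smt (verit) field_sum_of_halves)+
  then show "\<exists>(P, Q)\<in>S. \<forall>i<n. \<forall>j<n. dist (P $$ (i, j)) (A $$ (i, j)) < e \<and> dist (Q $$ (i, j)) (B $$ (i, j)) < e"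
    using PQ(1) by blast
qed

text \<open>Continuity is asked for only at \<open>(A, B)\<close> and along sequences from
  \<open>S\<close>; membership in \<open>S\<close> then supplies the carrier facts for the
  sequence.\<close>

lemma seq_closure_map:
  assumes "(A, B) \<in> seq_closure n S"
    and "\<And>X Y. (X, Y) \<in> S \<Longrightarrow> (f X Y, g X Y) \<in> S'"
    and "\<And>X Y. (\<And>m. (X m, Y m) \<in> S) \<Longrightarrow> entry_lim n X A \<Longrightarrow> entry_lim n Y B \<Longrightarrow>
      entry_lim n (\<lambda>m. f (X m) (Y m)) A' \<and> entry_lim n (\<lambda>m. g (X m) (Y m)) B'"
  shows "(A', B') \<in> seq_closure n S'"
proof -
  obtain X Y where XY: "\<And>m. (X m, Y m) \<in> S" "entry_lim n X A" "entry_lim n Y B"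
    using assms(1) by (rule seq_closureE) blast
  show ?thesis
    using assms(3)[OF XY] by (intro seq_closureI[where X = "\<lambda>m. f (X m) (Y m)" and Y = "\<lambda>m. g (X m) (Y m)"])
      (auto intro: assms(2) XY(1))
qed

text \<open>A Gauss transformation: the identity plus the column vector \<open>u\<close> times the
  unit row vector of index \<open>k\<close>. If \<open>u k = 0\<close>, negating \<open>u\<close>
  inverts it; a nonzero \<open>u k\<close> rescales the diagonal, as in
  \<open>cholesky_step\<close>.\<close>

definition elem_col :: "nat \<Rightarrow> nat \<Rightarrow> (nat \<Rightarrow> complex) \<Rightarrow> complex mat" where
  "elem_col n k u = mat n n (\<lambda>(i, j). (if i = j then 1 else 0) + (if j = k then u i else 0))"

lemma elem_col_carrier [simp]: "elem_col n k u \<in> carrier_mat n n"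
  by (simp add: elem_col_def)

lemma elem_col_dim [simp]: "dim_row (elem_col n k u) = n" "dim_col (elem_col n k u) = n"
  by (simp_all add: elem_col_def)

lemma elem_col_entry:
  "i < n \<Longrightarrow> j < n \<Longrightarrow> elem_col n k u $$ (i, j) = (if i = j then 1 else 0) + (if j = k then u i else 0)"
  by (simp add: elem_col_def)

lemma sum_delta_mult:
  fixes f :: "nat \<Rightarrow> 'a :: comm_ring_1"
  assumes "i < n"
  shows "(\<Sum>l<n. (if l = i then c else 0) * f l) = c * f i"
    "(\<Sum>l<n. (if i = l then c else 0) * f l) = c * f i"
    "(\<Sum>l<n. f l * (if l = i then c else 0)) = f i * c"
    "(\<Sum>l<n. f l * (if i = l then c else 0)) = f i * c"
  using assms by (simp_all add: if_distrib[of "\<lambda>x. x * _"] if_distrib[of "\<lambda>x. _ * x"] cong: if_cong)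

lemma elem_col_mult_entry:
  assumes "X \<in> carrier_mat n n" "i < n" "j < n" "k < n"
  shows "(elem_col n k u * X) $$ (i, j) = X $$ (i, j) + u i * X $$ (k, j)"
    "(transpose_mat (elem_col n k u) * X) $$ (i, j) = X $$ (i, j) + (if i = k then (\<Sum>l<n. u l * X $$ (l, j)) else 0)"
    "(X * transpose_mat (elem_col n k u)) $$ (i, j) = X $$ (i, j) + X $$ (i, k) * u j"
  using assms
  by (simp_all add: mult_entry[where n = n] elem_col_entry algebra_simps sum.distrib sum_delta_mult
      del: index_mult_mat cong: if_cong)

lemma elem_col_inverse:
  assumes "k < n" "u k = 0"
  shows "elem_col n k u * elem_col n k (\<lambda>i. - u i) = 1\<^sub>m n"
  by (rule eq_matI)
    (use assms in \<open>auto simp: elem_col_mult_entry elem_col_entry simp del: index_mult_mat(1)\<close>)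

lemma elem_col_inverse':
  assumes "k < n" "u k = 0"
  shows "elem_col n k (\<lambda>i. - u i) * elem_col n k u = 1\<^sub>m n"
  using elem_col_inverse[of k n "\<lambda>i. - u i"] assms by simp

lemma elem_col_lower:
  assumes "\<And>i. i < k \<Longrightarrow> u i = 0" "u k = 0"
  shows "inv_lower n (elem_col n k u)"
  using assms by (auto simp: inv_lower_def lower_tri_def elem_col_entry)

lemma elem_col_transpose_lower:
  assumes "\<And>i. k < i \<Longrightarrow> i < n \<Longrightarrow> u i = 0" "1 + u k \<noteq> 0"
  shows "inv_lower n (transpose_mat (elem_col n k u))"
  using assms by (auto simp: inv_lower_def lower_tri_def elem_col_entry)

section \<open>Lagrangian pairs\<close>

lemma mat_assoc:
  fixes A :: "'a :: semiring_0 mat"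
  shows "A \<in> carrier_mat n n \<Longrightarrow> B \<in> carrier_mat n n \<Longrightarrow> C \<in> carrier_mat n n \<Longrightarrow> A * B * C = A * (B * C)"
  by (rule assoc_mult_mat)

lemma transpose_mult_sq:
  fixes A :: "'a :: comm_semiring_0 mat"
  shows "A \<in> carrier_mat n n \<Longrightarrow> B \<in> carrier_mat n n \<Longrightarrow>
    transpose_mat (A * B) = transpose_mat B * transpose_mat A"
  by (rule transpose_mult)

lemma mat_cancel_mid:
  fixes A :: "'a :: semiring_1 mat"
  assumes "A \<in> carrier_mat n n" "B \<in> carrier_mat n n" "C \<in> carrier_mat n n" "B * C = 1\<^sub>m n"
  shows "A * B * C = A" "B * (C * A) = A"
proof -
  show "A * B * C = A"
    using assms by (simp add: mat_assoc[of A n])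
  show "B * (C * A) = A"
    using assms by (simp add: mat_assoc[symmetric, of B n])
qed

lemma mult_zero_vec:
  fixes A :: "'a :: semiring_0 mat"
  shows "A \<in> carrier_mat n n \<Longrightarrow> A *\<^sub>v 0\<^sub>v n = 0\<^sub>v n"
  by (intro eq_vecI) auto

text \<open>The columns of the stacked matrix with blocks \<open>L\<close> and \<open>N\<close> span a Lagrangian subspace.\<close>

definition lagrangian :: "nat \<Rightarrow> complex mat \<Rightarrow> complex mat \<Rightarrow> bool" where
  "lagrangian n L N \<longleftrightarrow> L \<in> carrier_mat n n \<and> N \<in> carrier_mat n n \<and>
     transpose_mat L * N = transpose_mat N * L \<and>
     (\<forall>x \<in> carrier_vec n. L *\<^sub>v x = 0\<^sub>v n \<and> N *\<^sub>v x = 0\<^sub>v n \<longrightarrow> x = 0\<^sub>v n)"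

lemma lagrangianD:
  assumes "lagrangian n L N"
  shows "L \<in> carrier_mat n n" "N \<in> carrier_mat n n" "transpose_mat L * N = transpose_mat N * L"
    "x \<in> carrier_vec n \<Longrightarrow> L *\<^sub>v x = 0\<^sub>v n \<Longrightarrow> N *\<^sub>v x = 0\<^sub>v n \<Longrightarrow> x = 0\<^sub>v n"
  using assms by (auto simp: lagrangian_def)

lemma lagrangian_swap: "lagrangian n L N \<Longrightarrow> lagrangian n N L"
  by (auto simp: lagrangian_def)

text \<open>\<open>B\<close> is the inverse transpose of \<open>A\<close>, so the block diagonal
  matrix of \<open>A\<close> and \<open>B\<close> is symplectic: the two cancel in
  \<open>(A L)^T (B N) = L^T N\<close>.\<close>

lemma lagrangian_left:
  assumes L: "lagrangian n L N" and A: "A \<in> carrier_mat n n" and B: "B \<in> carrier_mat n n"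
    and BA: "transpose_mat B * A = 1\<^sub>m n"
  shows "lagrangian n (A * L) (B * N)"
proof -
  note c = lagrangianD(1,2)[OF L] A B
  have AB: "transpose_mat A * B = 1\<^sub>m n"
    using arg_cong[OF BA, of transpose_mat] A B by (simp add: transpose_mult_sq[of _ n])
  have "transpose_mat (A * L) * (B * N) = transpose_mat L * (transpose_mat A * (B * N))"
    using c by (simp add: transpose_mult_sq[of _ n] mat_assoc[of _ n])
  also have "\<dots> = transpose_mat L * N"
    using c AB by (simp add: mat_cancel_mid[of _ n])
  also have "\<dots> = transpose_mat N * (transpose_mat B * (A * L))"
    using c BA lagrangianD(3)[OF L] by (simp add: mat_cancel_mid[of _ n])
  also have "\<dots> = transpose_mat (B * N) * (A * L)"
    using c by (simp add: transpose_mult_sq[of _ n] mat_assoc[of _ n])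
  finally have sym: "transpose_mat (A * L) * (B * N) = transpose_mat (B * N) * (A * L)" .
  have ker: "x = 0\<^sub>v n" if x: "x \<in> carrier_vec n" "(A * L) *\<^sub>v x = 0\<^sub>v n" "(B * N) *\<^sub>v x = 0\<^sub>v n" for x
  proof -
    have "L *\<^sub>v x = (transpose_mat B * A) *\<^sub>v (L *\<^sub>v x)"
      unfolding BA using c x by simp
    also have "\<dots> = transpose_mat B *\<^sub>v ((A * L) *\<^sub>v x)"
      using c x by (simp add: assoc_mult_mat_vec[of _ n n _ n])
    finally have 1: "L *\<^sub>v x = 0\<^sub>v n"
      using x c by (simp add: mult_zero_vec[of _ n])
    have "N *\<^sub>v x = (transpose_mat A * B) *\<^sub>v (N *\<^sub>v x)"
      unfolding AB using c x by simp
    also have "\<dots> = transpose_mat A *\<^sub>v ((B * N) *\<^sub>v x)"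
      using c x by (simp add: assoc_mult_mat_vec[of _ n n _ n])
    finally have "N *\<^sub>v x = 0\<^sub>v n"
      using x c by (simp add: mult_zero_vec[of _ n])
    with 1 show ?thesis
      using lagrangianD(4)[OF L x(1)] by simp
  qed
  show ?thesis
    unfolding lagrangian_def using c sym ker by auto
qed

text \<open>Only the basis of the Lagrangian subspace changes.\<close>

lemma lagrangian_right:
  assumes L: "lagrangian n L N" and T: "T \<in> carrier_mat n n" and T': "T' \<in> carrier_mat n n"
    and TT: "T' * T = 1\<^sub>m n"
  shows "lagrangian n (L * T) (N * T)"
proof -
  note c = lagrangianD(1,2)[OF L] T T'
  have "transpose_mat (L * T) * (N * T) = transpose_mat T * (transpose_mat L * N) * T"
    using c by (simp add: transpose_mult_sq[of _ n] mat_assoc[of _ n])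
  also have "\<dots> = transpose_mat (N * T) * (L * T)"
    unfolding lagrangianD(3)[OF L] using c by (simp add: transpose_mult_sq[of _ n] mat_assoc[of _ n])
  finally have sym: "transpose_mat (L * T) * (N * T) = transpose_mat (N * T) * (L * T)" .
  have ker: "x = 0\<^sub>v n" if x: "x \<in> carrier_vec n" "(L * T) *\<^sub>v x = 0\<^sub>v n" "(N * T) *\<^sub>v x = 0\<^sub>v n" for x
  proof -
    have "T *\<^sub>v x = 0\<^sub>v n"
      by (rule lagrangianD(4)[OF L]) (use x c in \<open>simp_all add: assoc_mult_mat_vec[of _ n n _ n]\<close>)
    then have "(T' * T) *\<^sub>v x = 0\<^sub>v n"
      using c x by (simp add: assoc_mult_mat_vec[of _ n n _ n] mult_zero_vec[of _ n])
    then show ?thesis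
      unfolding TT using x by simp
  qed
  show ?thesis
    unfolding lagrangian_def using c sym ker by auto
qed

text \<open>A symplectic shear: the extra term \<open>L^T C L\<close> is symmetric.\<close>

lemma lagrangian_shear:
  assumes L: "lagrangian n L N" and C: "C \<in> carrier_mat n n" "transpose_mat C = C"
  shows "lagrangian n L (N + C * L)"
proof -
  note c = lagrangianD(1,2)[OF L] C(1)
  have "transpose_mat L * (N + C * L) = transpose_mat L * N + transpose_mat L * (C * L)"
    using c by (simp add: mult_add_distrib_mat[of _ n n])
  also have "\<dots> = transpose_mat N * L + transpose_mat L * transpose_mat C * L"
    using c C(2) lagrangianD(3)[OF L] by (simp add: mat_assoc[of _ n])
  also have "\<dots> = transpose_mat (N + C * L) * L"
    using c by (simp add: transpose_mult_sq[of _ n] transpose_add[of _ n n] add_mult_distrib_mat[of _ n n])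
  finally have sym: "transpose_mat L * (N + C * L) = transpose_mat (N + C * L) * L" .
  have ker: "x = 0\<^sub>v n" if x: "x \<in> carrier_vec n" "L *\<^sub>v x = 0\<^sub>v n" "(N + C * L) *\<^sub>v x = 0\<^sub>v n" for x
  proof -
    have "(N + C * L) *\<^sub>v x = N *\<^sub>v x + C *\<^sub>v (L *\<^sub>v x)"
      using c x by (simp add: add_mult_distrib_mat_vec[of _ n n] assoc_mult_mat_vec[of _ n n _ n])
    then have "N *\<^sub>v x = 0\<^sub>v n"
      using c x by (simp add: mult_zero_vec[of _ n])
    then show ?thesis
      using x lagrangianD(4)[OF L] by simp
  qed
  show ?thesis
    unfolding lagrangian_def using c sym ker by auto
qed

text \<open>Entry \<open>(d, j)\<close> of \<open>L^T N = N^T L\<close>: on the left only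
  \<open>L $$ (d, d) * N $$ (d, j)\<close> survives, and the right side is zero.\<close>

lemma lagrangian_row_zero:
  assumes L: "lagrangian n L N" and d: "d < n" "L $$ (d, d) \<noteq> 0"
    and col: "\<And>l. l < n \<Longrightarrow> l \<noteq> d \<Longrightarrow> L $$ (l, d) = 0" "\<And>l. l < n \<Longrightarrow> N $$ (l, d) = 0"
    and j: "j < n"
  shows "N $$ (d, j) = 0"
proof -
  note c = lagrangianD(1,2)[OF L]
  have "(transpose_mat L * N) $$ (d, j) = (\<Sum>l<n. L $$ (l, d) * N $$ (l, j))"
    using c d j by (subst mult_entry[where n = n]) auto
  also have "\<dots> = (\<Sum>l<n. (if l = d then L $$ (d, d) else 0) * N $$ (l, j))"
    using col(1) by (intro sum.cong) auto
  also have "\<dots> = L $$ (d, d) * N $$ (d, j)"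
    using d by (simp add: sum_delta_mult)
  finally have 1: "(transpose_mat L * N) $$ (d, j) = L $$ (d, d) * N $$ (d, j)" .
  have "(transpose_mat N * L) $$ (d, j) = (\<Sum>l<n. N $$ (l, d) * L $$ (l, j))"
    using c d j by (subst mult_entry[where n = n]) auto
  also have "\<dots> = 0"
    using col(2) by (intro sum.neutral) auto
  finally show ?thesis
    using 1 lagrangianD(3)[OF L] d by simp
qed

section \<open>Approximating Lagrangian pairs by pairs with invertible first block\<close>

definition nonsingular_pairs :: "nat \<Rightarrow> (complex mat \<times> complex mat) set" where
  "nonsingular_pairs n = {(L, N). lagrangian n L N \<and> inv_lower n L}"

text \<open>Such operations preserve \<open>nonsingular_pairs\<close> and are continuous, so a pair
  may be brought to a simpler form, approximated there, and brought back.\<close>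

lemma closure_nonsingular_act:
  assumes cl: "(L, N) \<in> seq_closure n (nonsingular_pairs n)" and c: "L \<in> carrier_mat n n" "N \<in> carrier_mat n n"
    and A: "inv_lower n A" and B: "B \<in> carrier_mat n n" "transpose_mat B * A = 1\<^sub>m n"
    and T: "inv_lower n T"
  shows "(A * L * T, B * N * T) \<in> seq_closure n (nonsingular_pairs n)"
  using cl
proof (rule seq_closure_map)
  obtain T' where T': "lower_tri n T'" "T' * T = 1\<^sub>m n"
    using inv_lower_inverse[OF T] by blast
  note c' = inv_lowerD(1)[OF A] inv_lowerD(1)[OF T] B(1) c
  show "(A * X * T, B * Y * T) \<in> nonsingular_pairs n" if XY: "(X, Y) \<in> nonsingular_pairs n" for X Y
  proof -
    have "lagrangian n X Y" "inv_lower n X"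
      using XY by (simp_all add: nonsingular_pairs_def)
    then have "lagrangian n (A * X * T) (B * Y * T)" "inv_lower n (A * X * T)"
      using lagrangian_right[OF lagrangian_left[OF _ c'(1) B] c'(2) lower_triD(1)[OF T'(1)] T'(2)]
        inv_lower_mult[OF inv_lower_mult[OF A] T] by blast+
    then show ?thesis
      by (simp add: nonsingular_pairs_def)
  qed
  show "entry_lim n (\<lambda>m. A * X m * T) (A * L * T) \<and> entry_lim n (\<lambda>m. B * Y m * T) (B * N * T)"
    if "\<And>m. (X m, Y m) \<in> nonsingular_pairs n" "entry_lim n X L" "entry_lim n Y N" for X Y
  proof -
    have XY: "X m \<in> carrier_mat n n" "Y m \<in> carrier_mat n n" for m
      using that(1)[of m] by (auto simp: nonsingular_pairs_def lagrangian_def)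
    show ?thesis
      by (intro conjI; rule entry_lim_mult[OF entry_lim_mult[OF entry_lim_const that(2)] entry_lim_const]
          entry_lim_mult[OF entry_lim_mult[OF entry_lim_const that(3)] entry_lim_const])
        (simp_all add: XY c' mult_carrier_mat[of _ n n _ n])
  qed
qed

lemma closure_nonsingular_shear:
  assumes cl: "(L, N) \<in> seq_closure n (nonsingular_pairs n)" and c: "L \<in> carrier_mat n n" "N \<in> carrier_mat n n"
    and C: "C \<in> carrier_mat n n" "transpose_mat C = C"
  shows "(L, N + C * L) \<in> seq_closure n (nonsingular_pairs n)"
  using cl
proof (rule seq_closure_map)
  show "(X, Y + C * X) \<in> nonsingular_pairs n" if "(X, Y) \<in> nonsingular_pairs n" for X Y
    using that lagrangian_shear[of n X Y C] C by (auto simp: nonsingular_pairs_def)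
  show "entry_lim n X L \<and> entry_lim n (\<lambda>m. Y m + C * X m) (N + C * L)"
    if "\<And>m. (X m, Y m) \<in> nonsingular_pairs n" "entry_lim n X L" "entry_lim n Y N" for X Y
  proof -
    have XY: "X m \<in> carrier_mat n n" "Y m \<in> carrier_mat n n" for m
      using that(1)[of m] by (auto simp: nonsingular_pairs_def lagrangian_def)
    show ?thesis
      by (rule conjI[OF that(2)], rule entry_lim_add[OF that(3) entry_lim_mult[OF entry_lim_const that(2)]])
        (simp_all add: XY c C mult_carrier_mat[of _ n n _ n])
  qed
qed

text \<open>Each coordinate in \<open>D\<close> is a finished pivot: it splits off as a summand on
  which \<open>L\<close> is a nonzero scalar and \<open>N\<close> is zero. That the rows of
  \<open>N\<close> vanish too is a consequence of the Lagrangian condition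
  (\<open>decoupled_row\<close>).\<close>

definition decoupled :: "nat \<Rightarrow> nat set \<Rightarrow> complex mat \<Rightarrow> complex mat \<Rightarrow> bool" where
  "decoupled n D L N \<longleftrightarrow> D \<subseteq> {..<n} \<and> (\<forall>k\<in>D. L $$ (k, k) \<noteq> 0 \<and>
     (\<forall>j<n. (j \<noteq> k \<longrightarrow> L $$ (k, j) = 0 \<and> L $$ (j, k) = 0) \<and> N $$ (j, k) = 0))"

lemma decoupledD:
  assumes "decoupled n D L N" "k \<in> D"
  shows "k < n" "L $$ (k, k) \<noteq> 0" "j < n \<Longrightarrow> N $$ (j, k) = 0"
    "j < n \<Longrightarrow> j \<noteq> k \<Longrightarrow> L $$ (k, j) = 0" "j < n \<Longrightarrow> j \<noteq> k \<Longrightarrow> L $$ (j, k) = 0"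
  using assms by (auto simp: decoupled_def)

lemma decoupled_row:
  assumes "lagrangian n L N" "decoupled n D L N" "k \<in> D" "j < n"
  shows "N $$ (k, j) = 0"
  by (rule lagrangian_row_zero[OF assms(1)]) (use assms decoupledD[OF assms(2,3)] in auto)

text \<open>Gaussian elimination around the pivot by lower triangular row and column operations,
  then a symplectic shear to clear column \<open>k\<close> of \<open>N\<close>. Every operation is
  reversible and acts on the closure, so the enlarged \<open>D\<close> suffices.\<close>

lemma eliminate_pivot:
  assumes LN: "lagrangian n L N" and low: "lower_tri n L" and D: "decoupled n D L N"
    and k: "k < n" "k \<notin> D" "L $$ (k, k) \<noteq> 0"
    and IH: "\<And>L' N'. lagrangian n L' N' \<Longrightarrow> lower_tri n L' \<Longrightarrow> decoupled n (insert k D) L' N' \<Longrightarrow>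
      (L', N') \<in> seq_closure n (nonsingular_pairs n)"
  shows "(L, N) \<in> seq_closure n (nonsingular_pairs n)"
proof -
  note c = lagrangianD(1,2)[OF LN]
  define a where "a = L $$ (k, k)"
  \<comment> \<open>\<open>u\<close> clears column \<open>k\<close> of \<open>L\<close> below the
    pivot and \<open>v\<close> clears row \<open>k\<close> left of it; above and to the right
    \<open>L\<close> is zero already.\<close>
  define u where "u i = (if k < i \<and> i < n then L $$ (i, k) / a else 0)" for i
  define v where "v j = (if j < k then L $$ (k, j) / a else 0)" for j
  define E where "E = elem_col n k u"
  define E' where "E' = elem_col n k (\<lambda>i. - u i)"
  define F where "F = elem_col n k v"
  define F' where "F' = elem_col n k (\<lambda>i. - v i)"
  have a: "a \<noteq> 0"
    using k by (simp add: a_def)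
  have car: "E \<in> carrier_mat n n" "E' \<in> carrier_mat n n" "F \<in> carrier_mat n n" "F' \<in> carrier_mat n n"
    by (simp_all add: E_def E'_def F_def F'_def)
  have EE: "E * E' = 1\<^sub>m n" "E' * E = 1\<^sub>m n" and FF: "F * F' = 1\<^sub>m n" "F' * F = 1\<^sub>m n"
    using k unfolding E_def E'_def F_def F'_def
    by (auto intro!: elem_col_inverse elem_col_inverse' simp: u_def[of k] v_def[of k])
  have tr: "transpose_mat F * transpose_mat F' = 1\<^sub>m n" "transpose_mat F' * transpose_mat F = 1\<^sub>m n"
    "transpose_mat E' * transpose_mat E = 1\<^sub>m n"
    using EE FF by (simp_all flip: transpose_mult_sq[OF car(4,3)] transpose_mult_sq[OF car(3,4)]
        transpose_mult_sq[OF car(1,2)])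
  have Elow: "inv_lower n E" "inv_lower n E'" "inv_lower n (transpose_mat F)" "inv_lower n (transpose_mat F')"
    by (auto simp: E_def E'_def F_def F'_def u_def v_def intro!: elem_col_lower elem_col_transpose_lower)
  define L0 where "L0 = E' * L * transpose_mat F'"
  define N1 where "N1 = transpose_mat E * N * transpose_mat F'"
  have lag1: "lagrangian n L0 N1"
    unfolding L0_def N1_def using car tr EE
    by (intro lagrangian_right[where T' = "transpose_mat F"] lagrangian_left LN) auto
  have c1: "L0 \<in> carrier_mat n n" "N1 \<in> carrier_mat n n"
    using lagrangianD(1,2)[OF lag1] .
  have low1: "lower_tri n L0"
    unfolding L0_def by (intro lower_tri_mult low inv_lowerD(2) Elow)
  have L0: "L0 $$ (i, j) = (L $$ (i, j) - u i * L $$ (k, j)) - (L $$ (i, k) - u i * a) * v j"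
    if "i < n" "j < n" for i j
  proof -
    have "(E' * L) $$ (r, l) = L $$ (r, l) - u r * L $$ (k, l)" if "r < n" "l < n" for r l
      using that c k by (simp add: E'_def elem_col_mult_entry[where n = n] del: index_mult_mat(1))
    then show ?thesis
      using that c k car elem_col_mult_entry(3)[of "E' * L" n i j k "\<lambda>i. - v i"]
      by (simp add: L0_def F'_def a_def del: index_mult_mat(1))
  qed
  have N1: "N1 $$ (i, j) = (N $$ (i, j) + (if i = k then \<Sum>l<n. u l * N $$ (l, j) else 0))
      - (N $$ (i, k) + (if i = k then \<Sum>l<n. u l * N $$ (l, k) else 0)) * v j"
    if "i < n" "j < n" for i j
  proof -
    have "(transpose_mat E * N) $$ (r, l) = N $$ (r, l) + (if r = k then \<Sum>e<n. u e * N $$ (e, l) else 0)"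
      if "r < n" "l < n" for r l
      using that c k by (simp add: E_def elem_col_mult_entry[where n = n] del: index_mult_mat(1))
    then show ?thesis
      using that c k car elem_col_mult_entry(3)[of "transpose_mat E * N" n i j k "\<lambda>i. - v i"]
      by (simp add: N1_def F'_def del: index_mult_mat(1))
  qed
  have Lk: "L0 $$ (k, k) = a" "\<And>j. j < n \<Longrightarrow> j \<noteq> k \<Longrightarrow> L0 $$ (k, j) = 0" "\<And>j. j < n \<Longrightarrow> j \<noteq> k \<Longrightarrow> L0 $$ (j, k) = 0"
    using k a lower_triD(2)[OF low] by (auto simp: L0 u_def v_def a_def not_less)
  \<comment> \<open>Row and column \<open>d\<close> of \<open>L\<close> vanish off the diagonal, so
    the multipliers vanish at \<open>d\<close> and finished pivots are undisturbed.\<close>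
  have uvD: "u d = 0" "v d = 0" "d \<noteq> k" if "d \<in> D" for d
    using decoupledD[OF D that] k that by (auto simp: u_def v_def)
  have Ld: "L0 $$ (d, d) \<noteq> 0" "\<And>j. j < n \<Longrightarrow> j \<noteq> d \<Longrightarrow> L0 $$ (d, j) = 0" "\<And>j. j < n \<Longrightarrow> j \<noteq> d \<Longrightarrow> L0 $$ (j, d) = 0"
    "\<And>j. j < n \<Longrightarrow> N1 $$ (j, d) = 0" "\<And>j. j < n \<Longrightarrow> N1 $$ (d, j) = 0" if "d \<in> D" for d
    using decoupledD[OF D that] k uvD[OF that] decoupled_row[OF LN D that] by (auto simp: L0 N1)
  \<comment> \<open>Column \<open>k\<close> of \<open>L0\<close> is now \<open>a\<close> times a
    unit vector, so column \<open>k\<close> of \<open>C\<close> must be that of \<open>- N1\<close>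
    divided by \<open>a\<close>; the rest of row \<open>k\<close> is forced by symmetry. Its entries
    at \<open>D\<close> vanish, because the rows of \<open>N1\<close> in \<open>D\<close> do, so the
    columns of \<open>N1\<close> in \<open>D\<close> stay zero.\<close>
  define C where "C = mat n n (\<lambda>(i, j). if j = k then - N1 $$ (i, k) / a else if i = k then - N1 $$ (j, k) / a else 0)"
  have C: "C \<in> carrier_mat n n" "transpose_mat C = C"
    by (auto simp: C_def)
  define N2 where "N2 = N1 + C * L0"
  have lag2: "lagrangian n L0 N2"
    unfolding N2_def by (intro lagrangian_shear lag1 C)
  have N2: "N2 $$ (i, j) = N1 $$ (i, j) + C $$ (i, j) * L0 $$ (j, j)"
    if "i < n" "j < n" "\<And>l. l < n \<Longrightarrow> l \<noteq> j \<Longrightarrow> L0 $$ (l, j) = 0" for i j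
  proof -
    have "(C * L0) $$ (i, j) = (\<Sum>l<n. C $$ (i, l) * L0 $$ (l, j))"
      using that C c1 by (intro mult_entry) auto
    also have "\<dots> = (\<Sum>l<n. C $$ (i, l) * (if l = j then L0 $$ (j, j) else 0))"
      using that(3) by (intro sum.cong) auto
    also have "\<dots> = C $$ (i, j) * L0 $$ (j, j)"
      using that by (simp add: sum_delta_mult)
    finally show ?thesis
      using that C c1 by (simp add: N2_def del: index_mult_mat(1))
  qed
  have "N2 $$ (j, k) = 0" if "j < n" for j
    using that Lk k a by (subst N2) (auto simp: C_def)
  moreover have "N2 $$ (j, d) = 0" if "j < n" "d \<in> D" for j d
    using that Ld[OF that(2)] k decoupledD(1)[OF D that(2)] uvD[OF that(2)] by (subst N2) (auto simp: C_def)
  ultimately have "decoupled n (insert k D) L0 N2"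
    unfolding decoupled_def using Lk Ld k a D by (auto simp: decoupled_def)
  then have "(L0, N2) \<in> seq_closure n (nonsingular_pairs n)"
    by (intro IH lag2 low1)
  \<comment> \<open>From here the shear and then the elementary operations are undone inside the
    closure.\<close>
  then have "(L0, N2 + (- C) * L0) \<in> seq_closure n (nonsingular_pairs n)"
    using C lagrangianD(1,2)[OF lag2] by (intro closure_nonsingular_shear) (auto simp: transpose_uminus)
  also have "N2 + (- C) * L0 = N1"
    using C c1 by (intro eq_matI) (auto simp: N2_def simp del: index_mult_mat(1))
  finally have "(E * L0 * transpose_mat F, transpose_mat E' * N1 * transpose_mat F) \<in> seq_closure n (nonsingular_pairs n)"
    using c1 Elow car EE by (intro closure_nonsingular_act) auto
  moreover have "E * L0 * transpose_mat F = E * (E' * L) * (transpose_mat F' * transpose_mat F)"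
    unfolding L0_def using c car by (simp add: mat_assoc[of _ n])
  moreover have "E * (E' * L) * (transpose_mat F' * transpose_mat F) = L"
    using c car EE tr by (simp add: mat_cancel_mid[of _ n])
  moreover have "transpose_mat E' * N1 * transpose_mat F
      = transpose_mat E' * (transpose_mat E * N) * (transpose_mat F' * transpose_mat F)"
    unfolding N1_def using c car by (simp add: mat_assoc[of _ n])
  moreover have "transpose_mat E' * (transpose_mat E * N) * (transpose_mat F' * transpose_mat F) = N"
    using c car tr by (simp add: mat_cancel_mid[of _ n])
  ultimately show ?thesis
    by simp
qed

definition eps :: "nat \<Rightarrow> complex" where
  "eps m = of_real (inverse (real (Suc m)))"

lemma eps_nonzero [simp]: "eps m \<noteq> 0"
  unfolding eps_def of_real_eq_0_iff by simp

lemma LIMSEQ_add_eps_mult: "(\<lambda>m. a + eps m * b) \<longlonglongrightarrow> a"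
proof -
  have "(\<lambda>m. eps m) \<longlonglongrightarrow> of_real 0"
    unfolding eps_def by (rule tendsto_of_real[OF LIMSEQ_inverse_real_of_nat])
  then have "(\<lambda>m. a + eps m * b) \<longlonglongrightarrow> a + of_real 0 * b"
    by (rule tendsto_add[OF tendsto_const tendsto_mult[OF _ tendsto_const]])
  then show ?thesis
    by simp
qed

text \<open>A strictly lower triangular entry of minimal distance to the diagonal can be moved onto the
  diagonal by adding a small multiple of its row to an earlier row; this keeps \<open>L\<close> lower
  triangular.\<close>

lemma perturb_subdiagonal:
  assumes LN: "lagrangian n L N" and low: "lower_tri n L" and D: "decoupled n D L N"
    and ij: "i < n" "j < n" "i \<notin> D" "L $$ (i, j) \<noteq> 0" "j \<notin> D"
    and IH: "\<And>k L' N'. k < n \<Longrightarrow> k \<notin> D \<Longrightarrow> lagrangian n L' N' \<Longrightarrow> lower_tri n L' \<Longrightarrow>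
      decoupled n D L' N' \<Longrightarrow> L' $$ (k, k) \<noteq> 0 \<Longrightarrow> (L', N') \<in> seq_closure n (nonsingular_pairs n)"
  shows "(L, N) \<in> seq_closure n (nonsingular_pairs n)"
proof (cases "\<exists>k<n. k \<notin> D \<and> L $$ (k, k) \<noteq> 0")
  case True
  then show ?thesis
    using IH[OF _ _ LN low D] by blast
next
  case False
  define P where "P p \<longleftrightarrow> fst p < n \<and> snd p < n \<and> fst p \<notin> D \<and> snd p \<notin> D \<and> L $$ (fst p, snd p) \<noteq> 0" for p
  obtain p where p: "P p" "\<And>q. P q \<Longrightarrow> fst p - snd p \<le> fst q - snd q"
    using ex_has_least_nat[of P "(i, j)" "\<lambda>p. fst p - snd p"] ij by (auto simp: P_def)
  obtain k b where kb: "p = (k, b)"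
    by (cases p)
  have kb': "k < n" "b < n" "k \<notin> D" "b \<notin> D" "L $$ (k, b) \<noteq> 0"
    using p(1) by (auto simp: P_def kb)
  have min: "k - b \<le> l - c" if "l < n" "c < n" "l \<notin> D" "c \<notin> D" "L $$ (l, c) \<noteq> 0" for l c
    using p(2)[of "(l, c)"] that by (auto simp: P_def kb)
  have bk: "b < k"
    using kb' False lower_triD(2)[OF low, of k b] by (metis linorder_neqE_nat)
  \<comment> \<open>A nonzero entry of row \<open>k\<close> right of column \<open>b\<close> would
    lie closer to the diagonal than \<open>(k, b)\<close>. Hence row \<open>k\<close> added to row
    \<open>b\<close> puts nothing right of the diagonal.\<close>
  have row: "L $$ (k, c) = 0" if "b < c" "c < n" for c
  proof (rule ccontr)
    assume nz: "L $$ (k, c) \<noteq> 0"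
    have "c \<notin> D"
      using decoupledD(5)[OF D, of c k] nz kb' by auto
    then have "k - b \<le> k - c"
      using min[of k c] nz that kb' by auto
    moreover have "c \<le> k"
      using lower_triD(2)[OF low, of k c] nz that by (meson not_le)
    ultimately show False
      using that bk by simp
  qed
  note c = lagrangianD(1,2)[OF LN]
  define u :: "nat \<Rightarrow> nat \<Rightarrow> complex"
    where "u m l = (if l = b then eps m else 0)" for m l
  define X where "X m = elem_col n k (u m) * L" for m
  define Y where "Y m = transpose_mat (elem_col n k (\<lambda>l. - u m l)) * N" for m
  have u0: "u m k = 0" "u m b \<noteq> 0" for m
    using bk by (auto simp: u_def)
  have X: "X m $$ (l, c) = L $$ (l, c) + eps m * (if l = b then L $$ (k, c) else 0)"
    if "l < n" "c < n" for m l c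
    using that c kb' by (simp add: X_def elem_col_mult_entry[where n = n] u_def del: index_mult_mat(1))
  have Y: "Y m $$ (l, c) = N $$ (l, c) + eps m * (if l = k then - N $$ (b, c) else 0)"
    if "l < n" "c < n" for m l c
  proof -
    have "(\<Sum>e<n. - u m e * N $$ (e, c)) = (\<Sum>e<n. (if e = b then - eps m else 0) * N $$ (e, c))"
      by (intro sum.cong) (auto simp: u_def)
    also have "\<dots> = - eps m * N $$ (b, c)"
      by (rule sum_delta_mult(1)[OF kb'(2)])
    finally show ?thesis
      using that c kb' by (simp add: Y_def elem_col_mult_entry[where n = n] del: index_mult_mat(1))
  qed
  have "(X m, Y m) \<in> seq_closure n (nonsingular_pairs n)" for m
  proof (rule IH[OF kb'(2,4)])
    show "lagrangian n (X m) (Y m)"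
      unfolding X_def Y_def using LN kb' u0
      by (intro lagrangian_left) (auto simp: elem_col_inverse')
    show "lower_tri n (X m)"
      using low row c unfolding lower_tri_def by (auto simp: X) (simp add: X_def mult_carrier_mat[of _ n n _ n])
    have "L $$ (k, d) = 0" if "d \<in> D" for d
      using decoupledD(5)[OF D that kb'(1)] that kb'(3) by blast
    then show "decoupled n D (X m) (Y m)"
      using D decoupledD[OF D] decoupled_row[OF LN D] kb'
      unfolding decoupled_def by (auto simp: X Y)
    \<comment> \<open>In this case \<open>L $$ (b, b)\<close> is zero, so the new entry is
      \<open>eps m * L $$ (k, b)\<close>.\<close>
    show "X m $$ (b, b) \<noteq> 0"
      using kb' False X[of b b m] by auto
  qed
  moreover have "entry_lim n X L" "entry_lim n Y N"
    unfolding entry_lim_def by (auto simp: X Y LIMSEQ_add_eps_mult)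
  ultimately show ?thesis
    by (rule seq_closure_trans)
qed

text \<open>Induction on the number of coordinates outside \<open>D\<close>.  If \<open>L\<close> vanishes there, take the last such
  coordinate \<open>m\<close> and add \<open>eps e\<^sub>m e\<^sub>m\<^sup>T N\<close> to \<open>L\<close>: the coefficient matrix is symmetric, so the pair stays
  Lagrangian, and only row \<open>m\<close> changes, so \<open>L\<close> stays lower triangular.\<close>

lemma lagrangian_lower_in_closure:
  "lagrangian n L N \<Longrightarrow> lower_tri n L \<Longrightarrow> decoupled n D L N \<Longrightarrow> (L, N) \<in> seq_closure n (nonsingular_pairs n)"
proof (induction "n - card D" arbitrary: D L N rule: less_induct)
  case less
  note LN = less.prems(1) and low = less.prems(2) and D = less.prems(3)
  note c = lagrangianD(1,2)[OF LN]
  have Dn: "D \<subseteq> {..<n}"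
    using D by (simp add: decoupled_def)
  then have fin: "finite D"
    using finite_subset by blast
  have pivot: "(L', N') \<in> seq_closure n (nonsingular_pairs n)"
    if "k < n" "k \<notin> D" "lagrangian n L' N'" "lower_tri n L'" "decoupled n D L' N'" "L' $$ (k, k) \<noteq> 0" for k L' N'
  proof (rule eliminate_pivot[OF that(3,4,5,1,2,6)])
    have "card (insert k D) \<le> n"
      using Dn that(1) card_mono[of "{..<n}" "insert k D"] by auto
    then have "n - card (insert k D) < n - card D"
      using fin that(2) by auto
    then show "(L'', N'') \<in> seq_closure n (nonsingular_pairs n)"
      if "lagrangian n L'' N''" "lower_tri n L''" "decoupled n (insert k D) L'' N''" for L'' N''
      using less.hyps that by blast
  qed
  show ?case
  proof (cases "D = {..<n}")
    case True
    then have "(L, N) \<in> nonsingular_pairs n"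
      using LN low decoupledD(2)[OF D] by (auto simp: nonsingular_pairs_def inv_lower_def)
    then show ?thesis
      by (rule seq_closure_subset)
  next
    case ne: False
    show ?thesis
    proof (cases "\<exists>i<n. \<exists>j<n. i \<notin> D \<and> j \<notin> D \<and> L $$ (i, j) \<noteq> 0")
      case True
      then obtain i j where ij: "i < n" "j < n" "i \<notin> D" "L $$ (i, j) \<noteq> 0" "j \<notin> D"
        by blast
      show ?thesis
        by (rule perturb_subdiagonal[OF LN low D ij pivot])
    next
      case False
      have L0: "L $$ (i, j) = 0" if "i < n" "j < n" "i \<notin> D" for i j
        using False that decoupledD(5)[OF D, of j i] by blast
      \<comment> \<open>All columns beyond \<open>m\<close> lie in \<open>D\<close>, where
        \<open>N\<close> vanishes; so row \<open>m\<close> of \<open>N\<close> has no entry right of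
        the diagonal.\<close>
      define m where "m = Max ({..<n} - D)"
      have ne': "{..<n} - D \<noteq> {}"
        using ne Dn by blast
      then have m: "m < n" "m \<notin> D"
        using Max_in[of "{..<n} - D"] by (auto simp: m_def)
      have mmax: "j \<le> m" if "j < n" "j \<notin> D" for j
        using that by (auto simp: m_def)
      \<comment> \<open>Otherwise row \<open>m\<close> of \<open>L + N\<close> is zero and some
        \<open>x\<close> is in its kernel. In every row \<open>L\<close> or \<open>N\<close> is
        zero, according to membership in \<open>D\<close>, so \<open>L x\<close> and
        \<open>N x\<close> vanish separately, against the kernel condition of the pair.\<close>
      have "\<exists>j<n. N $$ (m, j) \<noteq> 0"
      proof (rule ccontr)
        assume "\<not> ?thesis"
        then have Nm: "\<And>j. j < n \<Longrightarrow> N $$ (m, j) = 0"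
          by blast
        have G: "L + N \<in> carrier_mat n n"
          using c by simp
        have "(L + N) $$ (m, j) = 0" if "j < n" for j
          using L0 m Nm c that by simp
        then have "det (L + N) = 0"
          by (simp add: laplace_expansion_row[OF G m(1)] del: index_add_mat)
        then obtain x where x: "x \<in> carrier_vec n" "x \<noteq> 0\<^sub>v n" "(L + N) *\<^sub>v x = 0\<^sub>v n"
          using det_0_iff_vec_prod_zero[OF G] by blast
        have ent: "(M *\<^sub>v x) $ i = (\<Sum>l<n. M $$ (i, l) * x $ l)" if "M \<in> carrier_mat n n" "i < n" for M :: "complex mat" and i
          using that x(1) by (auto simp: scalar_prod_def lessThan_atLeast0)
        have sum: "(L *\<^sub>v x) $ i + (N *\<^sub>v x) $ i = 0" if "i < n" for i
        proof -
          have "(L *\<^sub>v x) $ i + (N *\<^sub>v x) $ i = ((L + N) *\<^sub>v x) $ i"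
            using that c G by (simp add: ent distrib_right sum.distrib del: index_mult_mat_vec)
          then show ?thesis
            using x(3) that by simp
        qed
        have "(L *\<^sub>v x) $ i = 0 \<and> (N *\<^sub>v x) $ i = 0" if i: "i < n" for i
        proof (cases "i \<in> D")
          case True
          have "(N *\<^sub>v x) $ i = 0"
            using i c decoupled_row[OF LN D True] by (simp add: ent del: index_mult_mat_vec)
          then show ?thesis
            using sum[OF i] by simp
        next
          case False
          have "(L *\<^sub>v x) $ i = 0"
            using i c L0[OF i _ False] by (simp add: ent del: index_mult_mat_vec)
          then show ?thesis
            using sum[OF i] by simp
        qed
        then have "L *\<^sub>v x = 0\<^sub>v n" "N *\<^sub>v x = 0\<^sub>v n"
          using c by (auto intro!: eq_vecI simp del: index_mult_mat_vec)
        then show False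
          using lagrangianD(4)[OF LN x(1)] x(2) by blast
      qed
      then obtain j where j: "j < n" "N $$ (m, j) \<noteq> 0"
        by blast
      have jD: "j \<notin> D"
        using decoupledD(3)[OF D, of j m] j m by blast
      define e where "e t = eps t" for t
      define S where "S t = mat n n (\<lambda>(i, l). if i = m \<and> l = m then e t else 0)" for t
      define X where "X t = L + S t * N" for t
      have S: "S t \<in> carrier_mat n n" "transpose_mat (S t) = S t" for t
        by (auto simp: S_def)
      have X: "X t $$ (i, l) = L $$ (i, l) + e t * (if i = m then N $$ (m, l) else 0)" if "i < n" "l < n" for t i l
      proof -
        have "(S t * N) $$ (i, l) = (\<Sum>r<n. S t $$ (i, r) * N $$ (r, l))"
          using that S c by (intro mult_entry) auto
        also have "\<dots> = (\<Sum>r<n. (if r = m then (if i = m then e t else 0) else 0) * N $$ (r, l))"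
          using that by (intro sum.cong) (auto simp: S_def)
        also have "\<dots> = e t * (if i = m then N $$ (m, l) else 0)"
          using m by (simp add: sum_delta_mult)
        finally show ?thesis
          using that carrier_matD[OF S(1)] c by (simp add: X_def del: index_mult_mat(1))
      qed
      have "(X t, N) \<in> seq_closure n (nonsingular_pairs n)" for t
      proof -
        have e0: "e t \<noteq> 0"
          by (simp add: e_def)
        have 1: "lagrangian n (X t) N"
          unfolding X_def by (rule lagrangian_swap[OF lagrangian_shear[OF lagrangian_swap[OF LN] S]])
        have 2: "lower_tri n (X t)"
          unfolding lower_tri_def
        proof (intro conjI allI impI)
          show "X t \<in> carrier_mat n n"
            using lagrangianD(1)[OF 1] .
          show "X t $$ (i, l) = 0" if "i < n" "l < n" "i < l" for i l
          proof (cases "l \<in> D")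
            case True
            then show ?thesis
              using that decoupledD(3,5)[OF D True] m by (simp add: X)
          next
            case False
            then show ?thesis
              using that lower_triD(2)[OF low that(3,2)] mmax[OF that(2) False] by (auto simp: X)
          qed
        qed
        have 3: "decoupled n D (X t) N"
          using D decoupledD[OF D] decoupled_row[OF LN D] m
          unfolding decoupled_def by (auto simp: X)
        have 4: "X t $$ (m, j) \<noteq> 0"
          using L0[OF m(1) j(1) m(2)] j m e0 by (simp add: X)
        show ?thesis
          by (rule perturb_subdiagonal[OF 1 2 3 m(1) j(1) m(2) 4 jD pivot])
      qed
      moreover have "entry_lim n X L"
        unfolding entry_lim_def by (auto simp: X e_def LIMSEQ_add_eps_mult)
      ultimately show ?thesis
        by (rule seq_closure_trans) (rule entry_lim_const)
    qed
  qed
qed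

section \<open>Cholesky factors\<close>

text \<open>\<open>N L^-1\<close> has a Cholesky factorisation with plain transposes, in the order
  upper times lower; elimination therefore runs from the last index upwards.\<close>

definition cholesky_pairs :: "nat \<Rightarrow> (complex mat \<times> complex mat) set" where
  "cholesky_pairs n = {(L, transpose_mat W * W * L) | L W. inv_lower n L \<and> inv_lower n W}"

text \<open>With \<open>S'\<close> built from the Schur complement of the pivot
  \<open>(s, s)\<close>, \<open>S = E S' E^T\<close> for an upper triangular \<open>E\<close>. A
  factor \<open>W\<close> for \<open>S'\<close> becomes the factor \<open>W E^T\<close>, which is
  again lower triangular.\<close>

lemma cholesky_step:
  assumes s: "s < n" and S: "S \<in> carrier_mat n n" "transpose_mat S = S"
    and id: "\<And>i j. i < n \<Longrightarrow> j < n \<Longrightarrow> s < i \<or> s < j \<Longrightarrow> S $$ (i, j) = (if i = j then 1 else 0)"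
    and nz: "S $$ (s, s) \<noteq> 0"
    and IH: "\<And>S'. S' \<in> carrier_mat n n \<Longrightarrow> transpose_mat S' = S' \<Longrightarrow>
      (\<And>i j. i < n \<Longrightarrow> j < n \<Longrightarrow> s \<le> i \<or> s \<le> j \<Longrightarrow> S' $$ (i, j) = (if i = j then 1 else 0)) \<Longrightarrow>
      (1\<^sub>m n, S') \<in> seq_closure n {(1\<^sub>m n, transpose_mat W * W) | W. inv_lower n W}"
  shows "(1\<^sub>m n, S) \<in> seq_closure n {(1\<^sub>m n, transpose_mat W * W) | W. inv_lower n W}"
proof -
  define a where "a = S $$ (s, s)"
  define d where "d = csqrt a"
  have d: "d * d = a" "d \<noteq> 0"
    using nz power2_csqrt[of a] by (auto simp: d_def a_def power2_eq_square)
  \<comment> \<open>The value \<open>d - 1\<close> turns the diagonal 1 of the elementary matrix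
    into the square root \<open>d\<close> of the pivot.\<close>
  define u where "u i = (if i < s then S $$ (i, s) / d else if i = s then d - 1 else 0)" for i
  define E where "E = elem_col n s u"
  define S' where "S' = mat n n (\<lambda>(i, j). if i < s \<and> j < s then S $$ (i, j) - S $$ (i, s) * S $$ (j, s) / a
    else if i = j then 1 else 0)"
  have sym: "S $$ (i, j) = S $$ (j, i)" if "i < n" "j < n" for i j
    using that S by (metis carrier_matD index_transpose_mat(1))
  have E: "E \<in> carrier_mat n n" and S': "S' \<in> carrier_mat n n"
    by (simp_all add: E_def S'_def)
  have S'sym: "transpose_mat S' = S'"
    using s by (intro eq_matI) (auto simp: S'_def sym mult.commute)
  have cl: "(1\<^sub>m n, S') \<in> seq_closure n {(1\<^sub>m n, transpose_mat W * W) | W. inv_lower n W}"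
    using S' S'sym by (intro IH) (auto simp: S'_def)
  have ES: "E * S' * transpose_mat E = S"
  proof (rule eq_matI)
    fix i j assume "i < dim_row S" "j < dim_col S"
    then have ij: "i < n" "j < n"
      using S by auto
    have 1: "(E * S') $$ (r, l) = S' $$ (r, l) + u r * S' $$ (s, l)" if "r < n" "l < n" for r l
      using that S' s by (simp add: E_def elem_col_mult_entry[where n = n] del: index_mult_mat(1))
    have "(E * S' * transpose_mat E) $$ (i, j) = (E * S') $$ (i, j) + (E * S') $$ (i, s) * u j"
      unfolding E_def using ij s S' by (intro elem_col_mult_entry(3)) auto
    also have "\<dots> = S' $$ (i, j) + u i * S' $$ (s, j) + (S' $$ (i, s) + u i * S' $$ (s, s)) * u j"
      using ij s by (simp add: 1)
    also have "\<dots> = S $$ (i, j)"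
      using ij s d sym[of s j] sym[of i j] id[of i j]
      by (cases i s rule: linorder_cases; cases j s rule: linorder_cases)
        (auto simp: S'_def u_def a_def field_simps simp flip: d(1))
    finally show "(E * S' * transpose_mat E) $$ (i, j) = S $$ (i, j)" .
  qed (use S E in auto)
  have low: "inv_lower n (transpose_mat E)"
    unfolding E_def using d by (intro elem_col_transpose_lower) (auto simp: u_def)
  have "(1\<^sub>m n, E * S' * transpose_mat E) \<in> seq_closure n {(1\<^sub>m n, transpose_mat W * W) | W. inv_lower n W}"
    using cl
  proof (rule seq_closure_map)
    show "(X, E * Y * transpose_mat E) \<in> {(1\<^sub>m n, transpose_mat W * W) | W. inv_lower n W}"
      if mem: "(X, Y) \<in> {(1\<^sub>m n, transpose_mat W * W) | W. inv_lower n W}" for X Y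
    proof -
      obtain W where W: "X = 1\<^sub>m n" "Y = transpose_mat W * W" "inv_lower n W"
        using mem by blast
      have "E * Y * transpose_mat E = transpose_mat (W * transpose_mat E) * (W * transpose_mat E)"
        using E inv_lowerD(1)[OF W(3)] W(2) by (simp add: transpose_mult_sq[of _ n] mat_assoc[of _ n])
      then show ?thesis
        using W(1) inv_lower_mult[OF W(3) low] by blast
    qed
    show "entry_lim n X (1\<^sub>m n) \<and> entry_lim n (\<lambda>m. E * Y m * transpose_mat E) (E * S' * transpose_mat E)"
      if XY: "\<And>m. (X m, Y m) \<in> {(1\<^sub>m n, transpose_mat W * W) | W. inv_lower n W}"
        "entry_lim n X (1\<^sub>m n)" "entry_lim n Y S'" for X Y
    proof -
      have "Y m \<in> carrier_mat n n" for m
        using XY(1)[of m] inv_lowerD(1) by (auto intro!: mult_carrier_mat[of _ n n _ n])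
      then show ?thesis
        using XY(2) E S'
        by (intro conjI entry_lim_mult[OF entry_lim_mult[OF entry_lim_const XY(3)] entry_lim_const])
          (simp_all add: mult_carrier_mat[of _ n n _ n])
    qed
  qed
  then show ?thesis
    by (simp add: ES)
qed

text \<open>Induction on the size \<open>s\<close> of the leading block outside which
  \<open>S\<close> is the identity. Only a zero pivot can obstruct the step, and it is replaced by
  \<open>eps t\<close>.\<close>

lemma symmetric_in_closure:
  assumes "S \<in> carrier_mat n n" "transpose_mat S = S"
  shows "(1\<^sub>m n, S) \<in> seq_closure n {(1\<^sub>m n, transpose_mat W * W) | W. inv_lower n W}"
proof -
  let ?C = "seq_closure n {(1\<^sub>m n, transpose_mat W * W) | W. inv_lower n W}"
  have "(1\<^sub>m n, S) \<in> ?C"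
    if "s \<le> n" "S \<in> carrier_mat n n" "transpose_mat S = S"
      "\<And>i j. i < n \<Longrightarrow> j < n \<Longrightarrow> s \<le> i \<or> s \<le> j \<Longrightarrow> S $$ (i, j) = (if i = j then 1 else 0)" for s S
    using that
  proof (induction s arbitrary: S)
    case 0
    then have "S = 1\<^sub>m n"
      by (intro eq_matI) auto
    moreover have "inv_lower n (1\<^sub>m n)"
      by (simp add: inv_lower_def lower_tri_def)
    moreover have "transpose_mat (1\<^sub>m n) * 1\<^sub>m n = (1\<^sub>m n :: complex mat)"
      by simp
    ultimately show ?case
      by (intro seq_closure_subset) (metis (mono_tags, lifting) mem_Collect_eq)
  next
    case (Suc s)
    have step: "(1\<^sub>m n, S') \<in> ?C"
      if "S' \<in> carrier_mat n n" "transpose_mat S' = S'" "S' $$ (s, s) \<noteq> 0"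
        "\<And>i j. i < n \<Longrightarrow> j < n \<Longrightarrow> s < i \<or> s < j \<Longrightarrow> S' $$ (i, j) = (if i = j then 1 else 0)" for S'
      by (rule cholesky_step[of s n S']) (use that Suc in auto)
    show ?case
    proof (cases "S $$ (s, s) = 0")
      case False
      then show ?thesis
        by (intro step) (use Suc.prems in auto)
    next
      case True
      define X where "X t = mat n n (\<lambda>(i, j). S $$ (i, j) +
        eps t * (if i = s \<and> j = s then 1 else 0))" for t :: nat
      have sym: "S $$ (i, j) = S $$ (j, i)" if "i < n" "j < n" for i j
        using that Suc.prems(2,3) by (metis carrier_matD index_transpose_mat(1))
      have "(1\<^sub>m n, X t) \<in> ?C" for t
      proof (rule step)
        show "transpose_mat (X t) = X t"
          by (intro eq_matI) (auto simp: X_def sym)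
      qed (use True Suc.prems in \<open>auto simp: X_def Suc_le_eq\<close>)
      moreover have "entry_lim n X S"
        unfolding entry_lim_def by (auto simp: X_def LIMSEQ_add_eps_mult)
      ultimately show ?thesis
        by (rule seq_closure_trans[OF _ entry_lim_const])
    qed
  qed
  from this[of n S] show ?thesis
    using assms by simp
qed

text \<open>\<open>L\<close> stays fixed and only the symmetric \<open>N L^-1\<close> is perturbed;
  multiplying the approximations by \<open>L\<close> on the right returns to
  \<open>N\<close>.\<close>

lemma nonsingular_in_closure_cholesky:
  assumes "(L, N) \<in> nonsingular_pairs n"
  shows "(L, N) \<in> seq_closure n (cholesky_pairs n)"
proof -
  have lag: "lagrangian n L N" and low: "inv_lower n L"
    using assms by (auto simp: nonsingular_pairs_def)
  note c = lagrangianD(1,2)[OF lag]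
  obtain C where C: "lower_tri n C" "L * C = 1\<^sub>m n" "C * L = 1\<^sub>m n"
    using inv_lower_inverse[OF low] by blast
  have Cc: "C \<in> carrier_mat n n"
    using lower_triD(1)[OF C(1)] .
  have CL: "transpose_mat C * transpose_mat L = 1\<^sub>m n"
    using transpose_mult_sq[OF c(1) Cc] C by simp
  define S where "S = N * C"
  have Sc: "S \<in> carrier_mat n n"
    using c Cc by (simp add: S_def mult_carrier_mat[of _ n n _ n])
  have "transpose_mat S = transpose_mat C * (transpose_mat N * (L * C))"
    using c Cc C by (simp add: S_def transpose_mult_sq[of _ n])
  also have "\<dots> = transpose_mat C * (transpose_mat N * L) * C"
    using c Cc by (simp add: mat_assoc[of _ n])
  also have "\<dots> = transpose_mat C * (transpose_mat L * N) * C"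
    using lagrangianD(3)[OF lag] by simp
  also have "\<dots> = (transpose_mat C * transpose_mat L) * S"
    using c Cc by (simp add: S_def mat_assoc[of _ n])
  also have "\<dots> = S"
    using Sc CL by simp
  finally have "(1\<^sub>m n, S) \<in> seq_closure n {(1\<^sub>m n, transpose_mat W * W) | W. inv_lower n W}"
    using Sc by (intro symmetric_in_closure)
  then have "(L, S * L) \<in> seq_closure n (cholesky_pairs n)"
  proof (rule seq_closure_map)
    show "(L, Y * L) \<in> cholesky_pairs n"
      if "(X, Y) \<in> {(1\<^sub>m n, transpose_mat W * W) | W. inv_lower n W}" for X Y
      using that low by (auto simp: cholesky_pairs_def)
    show "entry_lim n (\<lambda>m. L) L \<and> entry_lim n (\<lambda>m. Y m * L) (S * L)"
      if XY: "\<And>m. (X m, Y m) \<in> {(1\<^sub>m n, transpose_mat W * W) | W. inv_lower n W}"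
        "entry_lim n X (1\<^sub>m n)" "entry_lim n Y S" for X Y
    proof -
      have "Y m \<in> carrier_mat n n" for m
        using XY(1)[of m] inv_lowerD(1) by (auto intro!: mult_carrier_mat[of _ n n _ n])
      then show ?thesis
        using c Sc by (intro conjI entry_lim_const entry_lim_mult[OF XY(3) entry_lim_const]) auto
    qed
  qed
  moreover have "S * L = N"
    using c Cc C by (simp add: S_def mat_cancel_mid[of _ n])
  ultimately show ?thesis
    by simp
qed

lemma lagrangian_lower_in_closure_cholesky:
  assumes "lagrangian n L N" "lower_tri n L"
  shows "(L, N) \<in> seq_closure n (cholesky_pairs n)"
proof -
  have "(L, N) \<in> seq_closure n (nonsingular_pairs n)"
    using assms by (intro lagrangian_lower_in_closure[where D = "{}"]) (auto simp: decoupled_def)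
  then obtain X Y where XY: "\<And>m. (X m, Y m) \<in> nonsingular_pairs n" "entry_lim n X L" "entry_lim n Y N"
    by (rule seq_closureE) blast
  show ?thesis
    by (rule seq_closure_trans[OF nonsingular_in_closure_cholesky[OF XY(1)] XY(2,3)])
qed

text \<open>Column operations clear the entries left of the diagonal, from the last row upwards.\<close>

lemma triangularize_near_identity:
  assumes N: "entry_lim n N (1\<^sub>m n)" and c: "\<And>m. N m \<in> carrier_mat n n"
  obtains T where "\<And>m. lower_tri n (T m)" "entry_lim n T (1\<^sub>m n)"
    "\<forall>\<^sub>F m in sequentially. \<forall>i<n. \<forall>j<i. (N m * T m) $$ (i, j) = 0"
proof -
  have "\<exists>T. (\<forall>m. lower_tri n (T m)) \<and> entry_lim n T (1\<^sub>m n) \<and>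
      (\<forall>\<^sub>F m in sequentially. \<forall>i<n. \<forall>j<i. n - s \<le> i \<longrightarrow> (N m * T m) $$ (i, j) = 0)" if "s \<le> n" for s
    using that
  proof (induction s)
    case 0
    show ?case
      by (intro exI[of _ "\<lambda>m. 1\<^sub>m n"]) (auto simp: lower_tri_def entry_lim_const)
  next
    case (Suc s)
    then obtain T where T: "\<And>m. lower_tri n (T m)" "entry_lim n T (1\<^sub>m n)"
      "\<forall>\<^sub>F m in sequentially. \<forall>i<n. \<forall>j<i. n - s \<le> i \<longrightarrow> (N m * T m) $$ (i, j) = 0"
      by auto
    define r where "r = n - Suc s"
    have r: "r < n"
      using Suc.prems by (simp add: r_def)
    define Y where "Y m = N m * T m" for m
    have Yc: "Y m \<in> carrier_mat n n" for m
      using c lower_triD(1)[OF T(1)] by (simp add: Y_def mult_carrier_mat[of _ n n _ n])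
    have "entry_lim n Y (1\<^sub>m n * 1\<^sub>m n)"
      unfolding Y_def using c lower_triD(1)[OF T(1)] by (intro entry_lim_mult N T(2)) auto
    then have Y: "entry_lim n Y (1\<^sub>m n)"
      by simp
    \<comment> \<open>The pivot tends to 1 and the entries left of it to 0, so \<open>v\<close>
      tends to 0. For small \<open>m\<close> the pivot may be zero; the quotient is then 0, and the
      clearing is claimed only eventually.\<close>
    define v where "v m j = (if j < r then - Y m $$ (r, j) / Y m $$ (r, r) else 0)" for m j
    define E where "E m = transpose_mat (elem_col n r (v m))" for m
    have Elow: "lower_tri n (E m)" for m
      unfolding E_def by (intro inv_lowerD(2) elem_col_transpose_lower) (auto simp: v_def)
    have lim_v: "(\<lambda>m. v m j) \<longlonglongrightarrow> 0" if "j < n" for j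
    proof (cases "j < r")
      case True
      have "(\<lambda>m. - Y m $$ (r, j) / Y m $$ (r, r)) \<longlonglongrightarrow> - (1\<^sub>m n $$ (r, j)) / 1\<^sub>m n $$ (r, r)"
        using r that by (intro tendsto_divide tendsto_minus entry_limD[OF Y]) auto
      then show ?thesis
        using True r that by (simp add: v_def)
    qed (simp add: v_def)
    have "(\<lambda>m. E m $$ (i, j)) \<longlonglongrightarrow> (1\<^sub>m n :: complex mat) $$ (i, j)" if "i < n" "j < n" for i j
    proof -
      have "(\<lambda>m. (if i = j then 1 else 0) + (if i = r then v m j else 0)) \<longlonglongrightarrow> (if i = j then 1 else 0) + (if i = r then 0 else 0 :: complex)"
        using lim_v[OF that(2)] by (intro tendsto_add tendsto_const, cases "i = r") simp_all
      then show ?thesis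
        using that by (auto simp: E_def elem_col_entry eq_commute)
    qed
    then have limE: "entry_lim n E (1\<^sub>m n)"
      by (simp add: entry_lim_def)
    have "entry_lim n (\<lambda>m. T m * E m) (1\<^sub>m n * 1\<^sub>m n)"
      using lower_triD(1)[OF T(1)] lower_triD(1)[OF Elow] by (intro entry_lim_mult T(2) limE) auto
    then have lim: "entry_lim n (\<lambda>m. T m * E m) (1\<^sub>m n)"
      by simp
    have "\<forall>\<^sub>F m in sequentially. Y m $$ (r, r) \<noteq> 0"
      using entry_limD[OF Y r r] r by (intro tendsto_imp_eventually_ne) auto
    with T(3) have "\<forall>\<^sub>F m in sequentially. \<forall>i<n. \<forall>j<i. n - Suc s \<le> i \<longrightarrow> (N m * (T m * E m)) $$ (i, j) = 0"
    proof eventually_elim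
      case (elim m)
      have "(N m * (T m * E m)) $$ (i, j) = 0" if "i < n" "j < i" "r \<le> i" for i j
      proof -
        have "N m * (T m * E m) = Y m * E m"
          unfolding Y_def using c lower_triD(1)[OF T(1)] lower_triD(1)[OF Elow] by (simp add: mat_assoc[of _ n])
        then have "(N m * (T m * E m)) $$ (i, j) = Y m $$ (i, j) + Y m $$ (i, r) * v m j"
          using that r Yc by (simp add: E_def elem_col_mult_entry[where n = n] del: index_mult_mat(1))
        \<comment> \<open>For \<open>i > r\<close> column \<open>r\<close> is left of the diagonal,
          so both entries were cleared before and adding column \<open>r\<close> does no
          harm.\<close>
        also have "\<dots> = 0"
          using that elim r unfolding Y_def[symmetric]
          by (cases "i = r") (auto simp: v_def r_def)
        finally show ?thesis .
      qed
      then show ?case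
        by (simp add: r_def)
    qed
    then show ?case
      using lim lower_tri_mult[OF T(1) Elow] by (intro exI[of _ "\<lambda>m. T m * E m"]) blast
  qed
  from this[of n] show thesis
    using that by auto
qed

section \<open>Minors and dependent columns\<close>

lemma det_zero_of_kernel:
  fixes F :: "nat \<Rightarrow> nat \<Rightarrow> 'a :: field"
  assumes "\<exists>q<m. x q \<noteq> 0" "\<And>p. p < m \<Longrightarrow> (\<Sum>q<m. F p q * x q) = 0"
  shows "det (mat m m (\<lambda>(p, q). F p q)) = 0"
proof -
  let ?A = "mat m m (\<lambda>(p, q). F p q)"
  have "?A *\<^sub>v vec m x = 0\<^sub>v m"
    using assms(2) by (intro eq_vecI) (auto simp: scalar_prod_def lessThan_atLeast0)
  moreover have "vec m x \<noteq> 0\<^sub>v m"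
    using assms(1) by (metis index_vec index_zero_vec(1))
  ultimately show ?thesis
    using det_0_iff_vec_prod_zero[of ?A m] by (metis mat_carrier vec_carrier)
qed

text \<open>If some \<^term>\<open>m\<close>-minor on the first \<open>m\<close> columns is nonzero, the cofactors of an appended row do
  not depend on that row and form a kernel vector.\<close>

lemma kernel_of_minors:
  fixes A :: "'r \<Rightarrow> nat \<Rightarrow> 'a :: field"
  assumes "\<And>f. f ` {..<m} \<subseteq> R \<Longrightarrow> det (mat m m (\<lambda>(p, q). A (f p) q)) = 0"
  shows "\<exists>x. (\<exists>q<m. x q \<noteq> 0) \<and> (\<forall>r\<in>R. (\<Sum>q<m. A r q * x q) = 0)"
  using assms
proof (induction m)
  case 0
  have "det (mat 0 0 (\<lambda>(p, q). A (f p) q)) = 1" for f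
    by (simp add: det_def)
  then show ?case
    using 0[of undefined] by simp
next
  case (Suc m)
  show ?case
  proof (cases "\<forall>f. f ` {..<m} \<subseteq> R \<longrightarrow> det (mat m m (\<lambda>(p, q). A (f p) q)) = 0")
    case True
    then obtain x where x: "\<exists>q<m. x q \<noteq> 0" "\<forall>r\<in>R. (\<Sum>q<m. A r q * x q) = 0"
      using Suc.IH by auto
    then show ?thesis
      by (intro exI[of _ "\<lambda>q. if q < m then x q else 0"]) (auto intro: less_SucI)
  next
    case False
    then obtain f where f: "f ` {..<m} \<subseteq> R" "det (mat m m (\<lambda>(p, q). A (f p) q)) \<noteq> 0"
      by blast
    define G where "G r = mat (Suc m) (Suc m) (\<lambda>(p, q). A (if p < m then f p else r) q)" for r
    define x where "x q = cofactor (G undefined) m q" for q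
    have del: "mat_delete (G r) m q = mat_delete (G undefined) m q" for r q
      by (auto simp: mat_delete_def G_def intro!: eq_matI)
    have "mat_delete (G undefined) m m = mat m m (\<lambda>(p, q). A (f p) q)"
      by (intro eq_matI) (auto simp: mat_delete_def G_def)
    then have xm: "x m \<noteq> 0"
      using f(2) by (simp add: x_def cofactor_def)
    have "(\<Sum>q<Suc m. A r q * x q) = 0" if "r \<in> R" for r
    proof -
      have "det (G r) = 0"
        unfolding G_def using f(1) that by (intro Suc.prems) (auto simp: image_subset_iff)
      moreover have "G r \<in> carrier_mat (Suc m) (Suc m)"
        by (simp add: G_def)
      ultimately have "(\<Sum>q<Suc m. G r $$ (m, q) * cofactor (G r) m q) = 0"
        using laplace_expansion_row[of "G r" "Suc m" m] by simp
      moreover have "G r $$ (m, q) * cofactor (G r) m q = A r q * x q" if "q < Suc m" for q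
        using that by (simp add: G_def cofactor_def x_def) (metis (no_types) G_def del)
      ultimately show ?thesis
        by simp
    qed
    with xm show ?thesis
      by (intro exI[of _ x]) auto
  qed
qed

text \<open>Rank bounds are handled through linear relations because these pass directly through
  products with triangular matrices, whereas minors would call for the Cauchy-Binet formula.\<close>

definition dependent_cols :: "complex mat \<Rightarrow> nat \<Rightarrow> nat set \<Rightarrow> bool" where
  "dependent_cols M a K \<longleftrightarrow> (\<exists>x. (\<exists>j\<in>K. x j \<noteq> 0) \<and> (\<forall>i<a. (\<Sum>j\<in>K. M $$ (i, j) * x j) = 0))"

text \<open>Only injective row selections need be checked, since a repeated row makes the
  determinant zero.\<close>

lemma kernel_on_set:
  fixes A :: "'r \<Rightarrow> 'k \<Rightarrow> 'a :: field"
  assumes g: "bij_betw g {..<m} K"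
    and det: "\<And>f. f ` {..<m} \<subseteq> R \<Longrightarrow> inj_on f {..<m} \<Longrightarrow> det (mat m m (\<lambda>(p, q). A (f p) (g q))) = 0"
  shows "\<exists>x. (\<exists>j\<in>K. x j \<noteq> 0) \<and> (\<forall>r\<in>R. (\<Sum>j\<in>K. A r j * x j) = 0)"
proof -
  have "det (mat m m (\<lambda>(p, q). A (f p) (g q))) = 0" if f: "f ` {..<m} \<subseteq> R" for f
  proof (cases "inj_on f {..<m}")
    case False
    then obtain p p' where p: "p < m" "p' < m" "p \<noteq> p'" "f p = f p'"
      by (auto simp: inj_on_def)
    show ?thesis
      by (rule det_identical_rows[of _ m p p']) (use p in \<open>auto intro!: eq_vecI\<close>)
  qed (use f det in blast)
  then obtain x where x: "\<exists>q<m. x q \<noteq> 0" "\<forall>r\<in>R. (\<Sum>q<m. A r (g q) * x q) = 0"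
    using kernel_of_minors[of m R "\<lambda>r q. A r (g q)"] by blast
  define y where "y j = x (the_inv_into {..<m} g j)" for j
  have yg: "y (g q) = x q" if "q < m" for q
    using that g by (simp add: y_def the_inv_into_f_f bij_betw_imp_inj_on)
  have "(\<Sum>j\<in>K. A r j * y j) = (\<Sum>q<m. A r (g q) * x q)" for r
    by (subst sum.reindex_bij_betw[OF g, symmetric]) (simp add: yg)
  moreover have "\<exists>j\<in>K. y j \<noteq> 0"
    using x(1) yg g by (metis bij_betw_apply lessThan_iff)
  ultimately show ?thesis
    using x(2) by (intro exI[of _ y]) auto
qed

text \<open>No injection sends \<open>card K\<close> row positions into \<open>R\<close>, so the
  condition on minors is vacuous.\<close>

lemma underdetermined_system:
  fixes A :: "'r \<Rightarrow> 'k \<Rightarrow> 'a :: field"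
  assumes "finite R" "finite K" "card R < card K"
  shows "\<exists>x. (\<exists>j\<in>K. x j \<noteq> 0) \<and> (\<forall>r\<in>R. (\<Sum>j\<in>K. A r j * x j) = 0)"
proof -
  obtain g where g: "bij_betw g {..<card K} K"
    using assms(2) ex_bij_betw_nat_finite atLeast0LessThan by metis
  show ?thesis
  proof (rule kernel_on_set[OF g])
    fix f assume "f ` {..<card K} \<subseteq> R" "inj_on f {..<card K}"
    then have "card K \<le> card R"
      using card_inj_on_le assms(1) by fastforce
    then show "det (mat (card K) (card K) (\<lambda>(p, q). A (f p) (g q))) = 0"
      using assms(3) by simp
  qed
qed

section \<open>Corner minors as column dependences\<close>

lemma pick_bij:
  assumes "finite J"
  shows "bij_betw (pick J) {..<card J} J"
proof (rule bij_betwI')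
  show "pick J x = pick J y \<longleftrightarrow> x = y" if "x \<in> {..<card J}" "y \<in> {..<card J}" for x y
    using that pick_mono_le by (metis lessThan_iff linorder_neqE_nat order_less_irrefl)
  show "pick J x \<in> J" if "x \<in> {..<card J}" for x
    using that pick_in_set_le by simp
  show "\<exists>x\<in>{..<card J}. y = pick J x" if "y \<in> J" for y
  proof (rule bexI)
    show "y = pick J (card {a\<in>J. a < y})"
      using pick_card_in_set[OF that] by simp
    have "{a\<in>J. a < y} \<subset> J"
      using that by auto
    then show "card {a\<in>J. a < y} \<in> {..<card J}"
      using assms by (simp add: psubset_card_mono)
  qed
qed

lemma pick_interval:
  assumes "q < b - a"
  shows "pick {a..<b} q = a + q"
proof -
  have "{x \<in> {a..<b}. x < a + q} = {a..<a + q}"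
    using assms by auto
  then show ?thesis
    using pick_card_in_set[of "a + q" "{a..<b}"] assms by simp
qed

lemma minor_corner:
  assumes M: "M \<in> carrier_mat n n" and ij: "i \<le> n" "1 \<le> j" "j \<le> n"
    and I: "I \<subseteq> {..<i}" "card I = r" and J: "J \<subseteq> {..<n - (j - 1)}" "card J = r"
  shows "submatrix (corner n M i j) I J = mat r r (\<lambda>(p, q). M $$ (pick I p, pick J q + (j - 1)))"
proof -
  have sets: "{k. k < n \<and> k \<in> {0..<i}} = {0..<i}" "{k. k < n \<and> k \<in> {j - 1..<n}} = {j - 1..<n}"
    using ij by auto
  have C: "corner n M i j = mat i (n - (j - 1)) (\<lambda>(p, q). M $$ (p, q + (j - 1)))"
    unfolding corner_def submatrix_def carrier_matD[OF M] sets card_atLeastLessThan diff_zero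
    by (intro eq_matI) (simp_all add: pick_interval add.commute)
  have rc: "{k. k < dim_row (corner n M i j) \<and> k \<in> I} = I" "{k. k < dim_col (corner n M i j) \<and> k \<in> J} = J"
    using I J unfolding C by auto
  have "pick I p < i" if "p < r" for p
    using that I pick_in_set_le by blast
  moreover have "pick J q < n - (j - 1)" if "q < r" for q
    using that J pick_in_set_le by blast
  ultimately show ?thesis
    unfolding submatrix_def rc I(2) J(2) by (intro eq_matI) (simp_all add: C)
qed

lemma minors_corner:
  assumes M: "M \<in> carrier_mat n n" and ij: "i \<le> n" "1 \<le> j" "j \<le> n"
  shows "minors r (corner n M i j) = {det (mat r r (\<lambda>(p, q). M $$ (pick I p, pick J q + (j - 1)))) | I J.
    I \<subseteq> {..<i} \<and> J \<subseteq> {..<n - (j - 1)} \<and> card I = r \<and> card J = r}"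
proof -
  have "{k. k < n \<and> k \<in> {0..<i}} = {0..<i}" "{k. k < n \<and> k \<in> {j - 1..<n}} = {j - 1..<n}"
    using ij by auto
  then have "dim_row (corner n M i j) = i" "dim_col (corner n M i j) = n - (j - 1)"
    using M by (simp_all add: corner_def dim_submatrix)
  then show ?thesis
    unfolding minors_def using minor_corner[OF M ij] by (intro Collect_cong ex_cong1) metis
qed

text \<open>A relation among the columns in \<open>K\<close> is a kernel vector for every minor on
  \<open>K\<close>; conversely vanishing minors yield one by \<open>kernel_on_set\<close>. If
  \<open>r\<close> exceeds \<open>i\<close> there are no minors, and \<open>r\<close> columns of
  height \<open>i\<close> are dependent anyway.\<close>

lemma minors_corner_zero_iff:
  fixes M :: "complex mat"
  assumes M: "M \<in> carrier_mat n n" and ij: "i \<le> n" "1 \<le> j" "j \<le> n"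
  shows "(\<forall>d \<in> minors r (corner n M i j). d = 0) \<longleftrightarrow>
    (\<forall>K \<subseteq> {j - 1..<n}. card K = r \<longrightarrow> dependent_cols M i K)"
proof (intro iffI allI impI ballI)
  fix K
  assume min: "\<forall>d \<in> minors r (corner n M i j). d = 0" and K: "K \<subseteq> {j - 1..<n}" "card K = r"
  define b where "b = j - 1"
  define J where "J = (\<lambda>x. x - b) ` K"
  have injK: "inj_on (\<lambda>x. x - b) K"
    using K(1) by (intro inj_on_diff_nat) (auto simp: b_def)
  have J: "card J = r" "finite J"
    using card_image[OF injK] K finite_subset[OF K(1)] by (simp_all add: J_def)
  have Js: "J \<subseteq> {..<n - b}"
  proof
    fix y assume "y \<in> J"
    then obtain x where "x \<in> K" "y = x - b"
      by (auto simp: J_def)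
    then show "y \<in> {..<n - b}"
      using K(1) by (auto simp: b_def intro!: diff_less_mono)
  qed
  have Kb: "x - b + b = x" if "x \<in> K" for x
    using K(1) that by (auto simp: b_def)
  have "bij_betw (\<lambda>x. x + b) J K"
    unfolding bij_betw_def J_def image_image by (auto simp: Kb)
  then have g: "bij_betw (\<lambda>q. pick J q + b) {..<r} K"
    using bij_betw_trans[OF pick_bij[OF J(2)]] J(1) by (simp add: o_def)
  have "\<exists>x. (\<exists>j\<in>K. x j \<noteq> 0) \<and> (\<forall>l\<in>{..<i}. (\<Sum>j\<in>K. M $$ (l, j) * x j) = 0)"
  proof (rule kernel_on_set[OF g])
    fix f assume f: "f ` {..<r} \<subseteq> {..<i}" "inj_on f {..<r}"
    define I where "I = f ` {..<r}"
    have I: "card I = r" "finite I" "I \<subseteq> {..<i}"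
      using f card_image[OF f(2)] by (simp_all add: I_def)
    \<comment> \<open>\<open>f\<close> lists its image in arbitrary order, while the minors use the
      increasing order \<open>pick I\<close>; \<open>s\<close> is the permutation between the two
      and costs only a sign.\<close>
    define s where "s p = (if p < r then the_inv_into {..<r} (pick I) (f p) else p)" for p
    have pI: "bij_betw (pick I) {..<r} I"
      using pick_bij[OF I(2)] I(1) by simp
    have fI: "bij_betw f {..<r} I"
      using f by (simp add: bij_betw_def I_def)
    have "bij_betw (the_inv_into {..<r} (pick I) \<circ> f) {..<r} {..<r}"
      using bij_betw_trans[OF fI bij_betw_the_inv_into[OF pI]] .
    then have "bij_betw s {..<r} {..<r}"
      by (rule bij_betw_cong[THEN iffD1, rotated]) (simp add: s_def)
    then have perm: "s permutes {0..<r}"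
      by (intro bij_imp_permutes) (auto simp: s_def lessThan_atLeast0)
    have ps: "pick I (s p) = f p" if "p < r" for p
      using that f_the_inv_into_f_bij_betw[OF pI, of "f p"] by (auto simp: s_def I_def)
    have sr: "s p < r" if "p < r" for p
      using permutes_in_image[OF perm, of p] that by simp
    let ?D = "mat r r (\<lambda>(p, q). M $$ (pick I p, pick J q + b))"
    have "det ?D = 0"
      using min I(1,3) J(1) Js unfolding minors_corner[OF M ij] b_def by blast
    moreover have "mat r r (\<lambda>(p, q). M $$ (f p, pick J q + b)) = mat r r (\<lambda>(p, q). ?D $$ (s p, q))"
      by (intro eq_matI) (auto simp: ps sr)
    ultimately show "det (mat r r (\<lambda>(p, q). M $$ (f p, pick J q + b))) = 0"
      using det_permute_rows[OF _ perm, of ?D] by simp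
  qed
  then show "dependent_cols M i K"
    by (simp add: dependent_cols_def Ball_def)
next
  fix d
  assume dep: "\<forall>K \<subseteq> {j - 1..<n}. card K = r \<longrightarrow> dependent_cols M i K"
    and d: "d \<in> minors r (corner n M i j)"
  define b where "b = j - 1"
  obtain I J where d: "d = det (mat r r (\<lambda>(p, q). M $$ (pick I p, pick J q + b)))"
    and I: "I \<subseteq> {..<i}" "card I = r" and J: "J \<subseteq> {..<n - b}" "card J = r"
    using d unfolding minors_corner[OF M ij] b_def by blast
  define K where "K = (\<lambda>x. x + b) ` J"
  have finJ: "finite J"
    using J(1) finite_subset by blast
  have "bij_betw (\<lambda>x. x + b) J K"
    by (auto simp: K_def bij_betw_def)
  then have g: "bij_betw (\<lambda>q. pick J q + b) {..<r} K"
    using bij_betw_trans[OF pick_bij[OF finJ]] J(2) by (simp add: o_def)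
  have "K \<subseteq> {b..<n}" "card K = r"
    using J by (auto simp: K_def card_image)
  then obtain x where x: "\<exists>j\<in>K. x j \<noteq> 0" "\<forall>l<i. (\<Sum>j\<in>K. M $$ (l, j) * x j) = 0"
    using dep unfolding b_def dependent_cols_def by blast
  show "d = 0"
    unfolding d
  proof (rule det_zero_of_kernel[where x = "\<lambda>q. x (pick J q + b)"])
    show "\<exists>q<r. x (pick J q + b) \<noteq> 0"
      using x(1) g unfolding bij_betw_def by (metis (no_types, lifting) image_iff lessThan_iff)
    show "(\<Sum>q<r. M $$ (pick I p, pick J q + b) * x (pick J q + b)) = 0" if "p < r" for p
    proof -
      have "pick I p < i"
        using that I pick_in_set_le by blast
      then show ?thesis
        using x(2) sum.reindex_bij_betw[OF g, of "\<lambda>j. M $$ (pick I p, j) * x j"] by simp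
    qed
  qed
qed

text \<open>Here \<open>b\<close> is the zero-based first column. The cardinality counts the ones of
  the permutation matrix of \<open>c\<close> in the corner, and dependence of any larger number of
  columns bounds the rank by it.\<close>

definition rank_bounded :: "nat \<Rightarrow> (nat \<Rightarrow> nat) \<Rightarrow> complex mat \<Rightarrow> bool" where
  "rank_bounded n c M \<longleftrightarrow> (\<forall>a b K. 1 \<le> a \<and> a \<le> n \<and> b < n \<and> K \<subseteq> {b..<n} \<and>
     card K = card {k. k < a \<and> b \<le> c k} + 1 \<longrightarrow> dependent_cols M a K)"

section \<open>A greedy column order\<close>

text \<open>Opposite corners of a permutation matrix determine each other's counts: exactly
  \<open>b\<close> indices have \<open>s k < b\<close>, and these are split at
  \<open>a\<close>.\<close>

lemma card_bij_corner:
  assumes s: "bij_betw s {..<n} {..<n}" and ab: "a \<le> n" "b \<le> n"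
  shows "card {k. k < a \<and> b \<le> s k} + b = a + card {k. a \<le> k \<and> k < n \<and> s k < b}"
proof -
  have "bij_betw s {k. k < n \<and> s k < b} {..<b}"
    using s ab(2) unfolding bij_betw_def inj_on_def
    by (auto simp: image_iff set_eq_iff) (metis lessThan_iff less_le_trans image_iff)
  then have "b = card {k. k < n \<and> s k < b}"
    using bij_betw_same_card by fastforce
  also have "{k. k < n \<and> s k < b} = {k. k < a \<and> s k < b} \<union> {k. a \<le> k \<and> k < n \<and> s k < b}"
    using ab by auto
  also have "card \<dots> = card {k. k < a \<and> s k < b} + card {k. a \<le> k \<and> k < n \<and> s k < b}"
    by (rule card_Un_disjoint) auto
  finally have 1: "b = card {k. k < a \<and> s k < b} + card {k. a \<le> k \<and> k < n \<and> s k < b}" .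
  have "card ({k. k < a \<and> s k < b} \<union> {k. k < a \<and> b \<le> s k})
      = card {k. k < a \<and> s k < b} + card {k. k < a \<and> b \<le> s k}"
    by (rule card_Un_disjoint) auto
  moreover have "{k. k < a \<and> s k < b} \<union> {k. k < a \<and> b \<le> s k} = {..<a}"
    by auto
  ultimately show ?thesis
    using 1 by simp
qed

text \<open>The order is built from the last position downwards, taking the largest admissible column each
  time: if that column is smaller than \<open>b\<close>, all admissible columns from \<open>b\<close> on are already used.\<close>

lemma greedy_order:
  fixes c :: "nat \<Rightarrow> nat"
  assumes c: "bij_betw c {..<n} {..<n}" and J: "\<And>a. J a \<subseteq> {..<n}"
    and card: "\<And>a b. a < n \<Longrightarrow> b < n \<Longrightarrow> card ({b..<n} - J a) \<le> card {k. k < a \<and> b \<le> c k}"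
  obtains s where "bij_betw s {..<n} {..<n}" "\<And>a. a < n \<Longrightarrow> s a \<in> J a"
    "\<And>a b. a \<le> n \<Longrightarrow> b \<le> n \<Longrightarrow> card {k. k < a \<and> b \<le> s k} \<le> card {k. k < a \<and> b \<le> c k}"
proof -
  \<comment> \<open>The bound is carried in the opposite corner, positions from \<open>a\<close> on
    and columns below \<open>b\<close>, because only late positions are filled so far;
    \<open>card_bij_corner\<close> converts it at the end.\<close>
  have "\<exists>s. inj_on s {n - m..<n} \<and> (\<forall>a. n - m \<le> a \<and> a < n \<longrightarrow> s a \<in> J a) \<and>
      (\<forall>a b. n - m \<le> a \<and> a \<le> n \<and> b \<le> n \<longrightarrow>
        card {k. a \<le> k \<and> k < n \<and> s k < b} \<le> card {k. a \<le> k \<and> k < n \<and> c k < b})" if "m \<le> n" for m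
    using that
  proof (induction m)
    case 0
    show ?case
      by (intro exI[of _ c]) auto
  next
    case (Suc m)
    define a where "a = n - Suc m"
    have a: "a < n" "n - m = Suc a"
      using Suc.prems by (auto simp: a_def)
    obtain s where s: "inj_on s {Suc a..<n}" "\<And>l. Suc a \<le> l \<Longrightarrow> l < n \<Longrightarrow> s l \<in> J l"
      "\<And>l b. Suc a \<le> l \<Longrightarrow> l \<le> n \<Longrightarrow> b \<le> n \<Longrightarrow>
        card {k. l \<le> k \<and> k < n \<and> s k < b} \<le> card {k. l \<le> k \<and> k < n \<and> c k < b}"
      using Suc a by auto
    define C where "C = s ` {Suc a..<n}"
    have C: "C \<subseteq> {..<n}" "card C = n - Suc a" "finite C"
    proof -
      have "s l < n" if "Suc a \<le> l" "l < n" for l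
        using s(2)[OF that] J by blast
      then show "C \<subseteq> {..<n}"
        by (auto simp: C_def)
    qed (simp_all add: C_def card_image[OF s(1)])
    have fin: "finite (J l)" for l
      using J finite_subset by blast
    have Jb: "n - b \<le> card (J a \<inter> {b..<n}) + card {k. k < a \<and> b \<le> c k}" if "b < n" for b
    proof -
      have "card {b..<n} = card (J a \<inter> {b..<n}) + card ({b..<n} - J a)"
        using card_Int_Diff[of "{b..<n}" "J a"] by (simp add: Int_commute)
      then show ?thesis
        using card[OF a(1) that] by simp
    qed
    \<comment> \<open>At \<open>b = 0\<close>, \<open>Jb\<close> gives at least \<open>n - a\<close>
      admissible columns, one more than are used.\<close>
    have "J a - C \<noteq> {}"
    proof
      assume "J a - C = {}"
      then have "card (J a) \<le> card C"
        using C by (intro card_mono) auto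
      moreover have "card (J a \<inter> {0..<n}) = card (J a)"
        using J[of a] by (intro arg_cong[where f = card]) auto
      moreover have "card {k. k < a \<and> 0 \<le> c k} = a"
        by simp
      ultimately show False
        using Jb[of 0] C(2) a(1) by simp
    qed
    define p where "p = Max (J a - C)"
    have p: "p \<in> J a" "p \<notin> C" "\<And>j. j \<in> J a \<Longrightarrow> p < j \<Longrightarrow> j \<in> C"
      using Max_in[of "J a - C"] Max_ge[of "J a - C"] \<open>J a - C \<noteq> {}\<close> fin
      by (fastforce simp: p_def)+
    define s' where "s' = s(a := p)"
    have s'l: "s' l = s l" if "Suc a \<le> l" for l
      using that by (simp add: s'_def)
    have ins: "{a..<n} = insert a {Suc a..<n}"
      using a by auto
    have "inj_on s' {a..<n}"
      unfolding ins using s(1) p(2) s'l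
      by (auto simp: inj_on_insert C_def inj_on_def s'_def)
    moreover have "s' l \<in> J l" if "a \<le> l" "l < n" for l
      using that s(2)[of l] p(1) by (cases "l = a") (auto simp: s'_def)
    moreover have "card {k. l \<le> k \<and> k < n \<and> s' k < b} \<le> card {k. l \<le> k \<and> k < n \<and> c k < b}"
      if l: "a \<le> l" "l \<le> n" "b \<le> n" for l b
    proof (cases "l = a")
      case False
      then have "{k. l \<le> k \<and> k < n \<and> s' k < b} = {k. l \<le> k \<and> k < n \<and> s k < b}"
        using l by (auto simp: s'_def)
      then show ?thesis
        using s(3)[of l b] l False by auto
    next
      case True
      show ?thesis
      proof (cases "p < b")
        case False
        then have "{k. l \<le> k \<and> k < n \<and> s' k < b} = {k. Suc a \<le> k \<and> k < n \<and> s k < b}"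
          using True by (auto simp: s'_def le_Suc_eq Suc_le_eq le_less split: if_splits)
        also have "card \<dots> \<le> card {k. Suc a \<le> k \<and> k < n \<and> c k < b}"
          using s(3) a l by auto
        also have "\<dots> \<le> card {k. l \<le> k \<and> k < n \<and> c k < b}"
          using True by (intro card_mono) auto
        finally show ?thesis .
      next
        case pb: True
        have "{k. l \<le> k \<and> k < n \<and> s' k < b} = insert a {k. Suc a \<le> k \<and> k < n \<and> s k < b}"
          using True pb a by (auto simp: s'_def le_less Suc_le_eq split: if_splits)
        then have 1: "card {k. l \<le> k \<and> k < n \<and> s' k < b} \<le> Suc (card {k. Suc a \<le> k \<and> k < n \<and> s k < b})"
          by (simp add: card_insert_if)
        have "s ` {k. Suc a \<le> k \<and> k < n \<and> s k < b} = C \<inter> {..<b}"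
          by (auto simp: C_def)
        moreover have "inj_on s {k. Suc a \<le> k \<and> k < n \<and> s k < b}"
          by (rule inj_on_subset[OF s(1)]) auto
        ultimately have 2: "card {k. Suc a \<le> k \<and> k < n \<and> s k < b} = card (C \<inter> {..<b})"
          using card_image by metis
        have "card C = card (C \<inter> {..<b}) + card (C \<inter> {b..<n})"
        proof -
          have "C - {..<b} = C \<inter> {b..<n}"
            using C(1) by auto
          then show ?thesis
            using card_Int_Diff[OF C(3), of "{..<b}"] by simp
        qed
        moreover have "J a \<inter> {b..<n} \<subseteq> C \<inter> {b..<n}"
          using p(3) pb by auto
        then have "card (J a \<inter> {b..<n}) \<le> card (C \<inter> {b..<n})"
          using C(3) by (intro card_mono) auto
        moreover have "n - b \<le> card (J a \<inter> {b..<n}) + card {k. k < a \<and> b \<le> c k}"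
          using Jb[of b] by (cases "b < n") auto
        \<comment> \<open>\<open>C\<close> contains all admissible columns from \<open>b\<close> on,
          which leaves few of its elements below \<open>b\<close>. Since \<open>C\<close> has
          \<open>n - Suc a\<close> elements rather than \<open>n - a\<close>, there is exactly room
          to count position \<open>a\<close> as well.\<close>
        ultimately have "card (C \<inter> {..<b}) + (n - b) \<le> (n - Suc a) + card {k. k < a \<and> b \<le> c k}"
          using C(2) by linarith
        moreover have "card {k. k < a \<and> b \<le> c k} + b = a + card {k. a \<le> k \<and> k < n \<and> c k < b}"
          using card_bij_corner[OF c] a l by simp
        ultimately show ?thesis
          using 1 2 a l unfolding True by linarith
      qed
    qed
    ultimately show ?case
      unfolding a_def[symmetric] by (intro exI[of _ s']) auto
  qed
  from this[of n] obtain s where s: "inj_on s {0..<n}" "\<And>a. a < n \<Longrightarrow> s a \<in> J a"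
    "\<And>a b. a \<le> n \<Longrightarrow> b \<le> n \<Longrightarrow>
      card {k. a \<le> k \<and> k < n \<and> s k < b} \<le> card {k. a \<le> k \<and> k < n \<and> c k < b}"
    by auto
  have "s ` {..<n} \<subseteq> {..<n}"
    using s(2) J by blast
  then have bij: "bij_betw s {..<n} {..<n}"
    using s(1) by (simp add: bij_betw_def endo_inj_surj lessThan_atLeast0)
  show thesis
  proof (rule that[OF bij s(2)])
    show "card {k. k < a \<and> b \<le> s k} \<le> card {k. k < a \<and> b \<le> c k}" if "a \<le> n" "b \<le> n" for a b
      using card_bij_corner[OF bij that] card_bij_corner[OF c that] s(3)[OF that] by linarith
  qed
qed

text \<open>\<open>lead a j z\<close>: the vector \<open>z\<close> has leading entry \<open>j\<close> and \<open>M z\<close> vanishes in all rows with index less than \<open>a\<close>.  The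
  columns \<open>j \<ge> b\<close> without such a \<open>z\<close> are independent in these rows, so the rank condition bounds their
  number.\<close>

lemma rank_bounded_factor:
  assumes M: "M \<in> carrier_mat n n" and c: "bij_betw c {..<n} {..<n}" and rk: "rank_bounded n c M"
  obtains s B P Q where "bij_betw s {..<n} {..<n}"
    "\<And>a b. a \<le> n \<Longrightarrow> b \<le> n \<Longrightarrow> card {k. k < a \<and> b \<le> s k} \<le> card {k. k < a \<and> b \<le> c k}"
    "lower_tri n B" "P \<in> carrier_mat n n" "Q = mat n n (\<lambda>(l, j). B $$ (s l, j))"
    "P * Q = 1\<^sub>m n" "Q * P = 1\<^sub>m n" "lower_tri n (M * P)"
proof -
  define lead where "lead a j z \<longleftrightarrow> z j = 1 \<and> (\<forall>i<j. z i = 0) \<and> (\<forall>i<a. (\<Sum>l<n. M $$ (i, l) * z l) = 0)"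
    for a j and z :: "nat \<Rightarrow> complex"
  define J where "J a = {j. j < n \<and> (\<exists>z. lead a j z)}" for a
  have J_card: "card ({b..<n} - J a) \<le> card {k. k < a \<and> b \<le> c k}" if ab: "a < n" "b < n" for a b
  proof (rule ccontr)
    assume "\<not> ?thesis"
    then obtain K where K: "K \<subseteq> {b..<n} - J a" "card K = card {k. k < a \<and> b \<le> c k} + 1"
      by (metis Suc_eq_plus1 Suc_leI not_le obtain_subset_with_card_n)
    have fin: "finite K"
      using K(1) finite_subset by blast
    have "\<exists>x. (\<exists>j\<in>K. x j \<noteq> 0) \<and> (\<forall>i<a. (\<Sum>j\<in>K. M $$ (i, j) * x j) = 0)"
    \<comment> \<open>\<open>rank_bounded\<close> starts at \<open>a = 1\<close>; with no rows, any
      nonzero \<open>x\<close> is a relation.\<close>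
    proof (cases "a = 0")
      case True
      have "K \<noteq> {}"
        using K(2) by auto
      then show ?thesis
        using True by (intro exI[of _ "\<lambda>_. 1"]) auto
    next
      case False
      then have "dependent_cols M a K"
        using rk[unfolded rank_bounded_def, rule_format, of a b K] K ab by auto
      then show ?thesis
        by (simp add: dependent_cols_def)
    qed
    then obtain x where x: "\<exists>j\<in>K. x j \<noteq> 0" "\<forall>i<a. (\<Sum>j\<in>K. M $$ (i, j) * x j) = 0"
      by blast
    \<comment> \<open>The first column of the relation becomes the leading index of a normalised
      vector, so it lies in \<open>J a\<close>, although \<open>K\<close> was chosen outside
      \<open>J a\<close>.\<close>
    define j where "j = Min {j\<in>K. x j \<noteq> 0}"
    have j: "j \<in> K" "x j \<noteq> 0"
      using Min_in[of "{j\<in>K. x j \<noteq> 0}"] x(1) fin by (auto simp: j_def)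
    have jmin: "x i = 0" if "i < j" "i \<in> K" for i
    proof (rule ccontr)
      assume "x i \<noteq> 0"
      then have "j \<le> i"
        unfolding j_def using that(2) fin by (intro Min_le) auto
      then show False
        using that(1) by simp
    qed
    define z where "z i = (if i \<in> K then x i / x j else 0)" for i
    have "(\<Sum>l<n. M $$ (i, l) * z l) = (\<Sum>l\<in>K. M $$ (i, l) * x l) / x j" for i
    proof -
      have "(\<Sum>l<n. M $$ (i, l) * z l) = (\<Sum>l\<in>K. M $$ (i, l) * z l)"
        using K(1) by (intro sum.mono_neutral_right) (auto simp: z_def)
      also have "\<dots> = (\<Sum>l\<in>K. M $$ (i, l) * x l / x j)"
        by (intro sum.cong) (auto simp: z_def)
      finally show ?thesis
        by (simp add: sum_divide_distrib)
    qed
    then have "lead a j z"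
      unfolding lead_def using j x(2) jmin by (auto simp: z_def)
    then have "j \<in> J a"
      using j(1) K(1) by (auto simp: J_def)
    then show False
      using j(1) K(1) by auto
  qed
  have J_sub: "J a \<subseteq> {..<n}" for a
    by (auto simp: J_def)
  obtain s where s: "bij_betw s {..<n} {..<n}" "\<And>a. a < n \<Longrightarrow> s a \<in> J a"
    "\<And>a b. a \<le> n \<Longrightarrow> b \<le> n \<Longrightarrow> card {k. k < a \<and> b \<le> s k} \<le> card {k. k < a \<and> b \<le> c k}"
    using greedy_order[OF c J_sub J_card] by blast
  have "\<forall>a. \<exists>z. a < n \<longrightarrow> lead a (s a) z"
    using s(2) by (auto simp: J_def)
  then obtain Z where Z: "\<And>a. a < n \<Longrightarrow> lead a (s a) (Z a)"
    by metis
  define t where "t = the_inv_into {..<n} s"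
  have t: "t (s a) = a" if "a < n" for a
    using that s(1) by (simp add: t_def the_inv_into_f_f bij_betw_imp_inj_on)
  have t': "t j < n" "s (t j) = j" if "j < n" for j
    using that bij_betw_the_inv_into[OF s(1)] f_the_inv_into_f_bij_betw[OF s(1)]
    by (auto simp: t_def bij_betw_def)
  have sn: "s a < n" if "a < n" for a
    using that s(1) by (auto simp: bij_betw_def)
  \<comment> \<open>Sorted by leading index, the vectors \<open>Z\<close> form a unit lower
    triangular \<open>A\<close>. \<open>P\<close> is \<open>A\<close> with its columns permuted by
    \<open>s\<close>, so its inverse \<open>Q\<close> is \<open>B\<close>, the inverse of
    \<open>A\<close>, with its rows permuted by \<open>s\<close>.\<close>
  define A where "A = mat n n (\<lambda>(i, j). Z (t j) i)"
  have "Z (t j) j = 1" "\<And>i. i < j \<Longrightarrow> Z (t j) i = 0" if "j < n" for j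
    using Z[OF t'(1)[OF that]] t'(2)[OF that] by (simp_all add: lead_def)
  then have "inv_lower n A"
    unfolding inv_lower_def lower_tri_def by (simp add: A_def)
  then obtain B where B: "lower_tri n B" "A * B = 1\<^sub>m n" "B * A = 1\<^sub>m n"
    by (rule inv_lower_inverse)
  define P where "P = mat n n (\<lambda>(i, a). Z a i)"
  define Q where "Q = mat n n (\<lambda>(l, j). B $$ (s l, j))"
  have PQ: "P * Q = 1\<^sub>m n"
  proof (rule eq_matI)
    fix i j assume "i < dim_row (1\<^sub>m n :: complex mat)" "j < dim_col (1\<^sub>m n :: complex mat)"
    then have ij: "i < n" "j < n"
      by auto
    have "(P * Q) $$ (i, j) = (\<Sum>a<n. P $$ (i, a) * Q $$ (a, j))"
      using ij by (intro mult_entry) (auto simp: P_def Q_def)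
    also have "\<dots> = (\<Sum>a<n. A $$ (i, s a) * B $$ (s a, j))"
      using ij by (intro sum.cong) (auto simp: P_def Q_def A_def sn t)
    also have "\<dots> = (\<Sum>l<n. A $$ (i, l) * B $$ (l, j))"
      by (rule sum.reindex_bij_betw[OF s(1)])
    also have "\<dots> = (A * B) $$ (i, j)"
      using ij lower_triD(1)[OF B(1)] by (intro mult_entry[symmetric]) (auto simp: A_def)
    finally show "(P * Q) $$ (i, j) = 1\<^sub>m n $$ (i, j)"
      using B(2) by simp
  qed (auto simp: P_def Q_def)
  have "Q * P = 1\<^sub>m n"
    by (rule mat_mult_left_right_inverse[OF _ _ PQ]) (auto simp: P_def Q_def)
  moreover have "lower_tri n (M * P)"
  proof -
    have "(M * P) $$ (i, j) = 0" if "i < n" "j < n" "i < j" for i j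
    proof -
      have "(M * P) $$ (i, j) = (\<Sum>l<n. M $$ (i, l) * P $$ (l, j))"
        using that M by (intro mult_entry) (auto simp: P_def)
      also have "\<dots> = (\<Sum>l<n. M $$ (i, l) * Z j l)"
        using that by (intro sum.cong) (auto simp: P_def)
      finally show ?thesis
        using Z[OF that(2)] that(3) by (simp add: lead_def)
    qed
    then show ?thesis
      using M by (simp add: lower_tri_def P_def)
  qed
  ultimately show thesis
    using that[OF s(1,3) B(1), of P Q] PQ by (auto simp: P_def Q_def)
qed

text \<open>Row \<open>l\<close> of \<open>Q T\<close> is row \<open>s l\<close> of the lower
  triangular \<open>B T\<close>, hence zero from column \<open>b\<close> on unless
  \<open>b \<le> s l\<close>. So the first \<open>a\<close> rows impose fewer than
  \<open>card K\<close> equations, and multiplying by \<open>X\<close> only combines them.\<close>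

lemma rank_bounded_lower_mult:
  assumes s: "\<And>a b. a \<le> n \<Longrightarrow> b \<le> n \<Longrightarrow> card {k. k < a \<and> b \<le> s k} \<le> card {k. k < a \<and> b \<le> c k}"
    and sn: "\<And>l. l < n \<Longrightarrow> s l < n"
    and B: "lower_tri n B" and X: "lower_tri n X" and T: "lower_tri n T"
  shows "rank_bounded n c (X * mat n n (\<lambda>(l, j). B $$ (s l, j)) * T)"
proof -
  define Q where "Q = mat n n (\<lambda>(l, j). B $$ (s l, j))"
  define H where "H = B * T"
  have H: "lower_tri n H"
    unfolding H_def by (intro lower_tri_mult B T)
  note car = lower_triD(1)[OF B] lower_triD(1)[OF X] lower_triD(1)[OF T]
  have Q: "Q \<in> carrier_mat n n"
    by (simp add: Q_def)
  have QT: "(Q * T) $$ (l, j) = H $$ (s l, j)" if "l < n" "j < n" for l j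
  proof -
    have "(Q * T) $$ (l, j) = (\<Sum>r<n. Q $$ (l, r) * T $$ (r, j))"
      using that car Q by (intro mult_entry)
    also have "\<dots> = (\<Sum>r<n. B $$ (s l, r) * T $$ (r, j))"
      using that by (intro sum.cong) (auto simp: Q_def)
    also have "\<dots> = H $$ (s l, j)"
      unfolding H_def using that car sn by (intro mult_entry[symmetric]) auto
    finally show ?thesis .
  qed
  have "dependent_cols (X * Q * T) a K"
    if K: "1 \<le> a" "a \<le> n" "b < n" "K \<subseteq> {b..<n}" "card K = card {k. k < a \<and> b \<le> c k} + 1" for a b K
  proof -
    have "card {k. k < a \<and> b \<le> s k} < card K"
      using s[of a b] K by simp
    then obtain x where x: "\<exists>j\<in>K. x j \<noteq> 0" "\<forall>l\<in>{k. k < a \<and> b \<le> s k}. (\<Sum>j\<in>K. H $$ (s l, j) * x j) = 0"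
      using underdetermined_system[of "{k. k < a \<and> b \<le> s k}" K "\<lambda>l j. H $$ (s l, j)"] K(4)
        finite_subset[OF K(4)] by auto
    have zero: "(\<Sum>j\<in>K. H $$ (s l, j) * x j) = 0" if "l < a" for l
    proof (cases "b \<le> s l")
      case True
      then show ?thesis
        using x(2) that by simp
    next
      case False
      have "H $$ (s l, j) = 0" if "j \<in> K" for j
        using lower_triD(2)[OF H, of "s l" j] that False K(4) by auto
      then show ?thesis
        by (intro sum.neutral) simp
    qed
    have "(\<Sum>j\<in>K. (X * Q * T) $$ (i, j) * x j) = 0" if i: "i < a" for i
    proof -
      have "(X * Q * T) $$ (i, j) = (\<Sum>l<n. X $$ (i, l) * H $$ (s l, j))" if "j \<in> K" for j
      proof -
        have j: "j < n"
          using that K(4) by auto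
        have "(X * Q * T) $$ (i, j) = (X * (Q * T)) $$ (i, j)"
          using car Q by (simp add: assoc_mult_mat[of _ n n _ n _ n])
        also have "\<dots> = (\<Sum>l<n. X $$ (i, l) * (Q * T) $$ (l, j))"
          using i K(2) j car Q by (intro mult_entry) (auto intro: mult_carrier_mat[of _ n n _ n])
        also have "\<dots> = (\<Sum>l<n. X $$ (i, l) * H $$ (s l, j))"
          using j by (intro sum.cong) (auto simp: QT)
        finally show ?thesis .
      qed
      then have "(\<Sum>j\<in>K. (X * Q * T) $$ (i, j) * x j) = (\<Sum>j\<in>K. \<Sum>l<n. X $$ (i, l) * (H $$ (s l, j) * x j))"
        by (intro sum.cong) (auto simp: sum_distrib_right mult.assoc)
      also have "\<dots> = (\<Sum>l<n. X $$ (i, l) * (\<Sum>j\<in>K. H $$ (s l, j) * x j))"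
        unfolding sum_distrib_left by (rule sum.swap)
      also have "\<dots> = 0"
      proof (intro sum.neutral ballI)
        fix l assume "l \<in> {..<n}"
        then show "X $$ (i, l) * (\<Sum>j\<in>K. H $$ (s l, j) * x j) = 0"
          using zero[of l] lower_triD(2)[OF X, of i l] i by (cases "l < a") auto
      qed
      finally show ?thesis .
    qed
    then show ?thesis
      unfolding dependent_cols_def using x(1) by blast
  qed
  then show ?thesis
    unfolding rank_bounded_def Q_def by blast
qed

section \<open>Evaluation of polynomials\<close>

definition eval_monom :: "complex mat \<Rightarrow> ((nat \<times> nat) \<Rightarrow>\<^sub>0 nat) \<Rightarrow> complex" where
  "eval_monom A m = (\<Prod>x \<in> Poly_Mapping.keys m. (A $$ x) ^ Poly_Mapping.lookup m x)"

lemma eval_monom_superset: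
  assumes "finite S" "Poly_Mapping.keys m \<subseteq> S"
  shows "eval_monom A m = (\<Prod>x\<in>S. (A $$ x) ^ Poly_Mapping.lookup m x)"
  unfolding eval_monom_def using assms
  by (intro prod.mono_neutral_left) (auto simp: in_keys_iff)

lemma eval_monom_add: "eval_monom A (m + m') = eval_monom A m * eval_monom A m'"
proof -
  let ?S = "Poly_Mapping.keys m \<union> Poly_Mapping.keys m'"
  have "eval_monom A (m + m') = (\<Prod>x\<in>?S. (A $$ x) ^ Poly_Mapping.lookup (m + m') x)"
    using keys_add[of m m'] by (intro eval_monom_superset) auto
  also have "\<dots> = (\<Prod>x\<in>?S. (A $$ x) ^ Poly_Mapping.lookup m x) * (\<Prod>x\<in>?S. (A $$ x) ^ Poly_Mapping.lookup m' x)"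
    by (simp add: lookup_add power_add prod.distrib)
  finally show ?thesis
    by (simp add: eval_monom_superset[of ?S])
qed

lemma eval_at_superset:
  assumes "finite S" "Poly_Mapping.keys p \<subseteq> S"
  shows "eval_at A p = (\<Sum>m\<in>S. Poly_Mapping.lookup p m * eval_monom A m)"
  unfolding eval_at_def eval_monom_def[symmetric] using assms
  by (intro sum.mono_neutral_left) (auto simp: in_keys_iff)

lemma eval_at_add: "eval_at A (p + q) = eval_at A p + eval_at A q"
proof -
  let ?S = "Poly_Mapping.keys p \<union> Poly_Mapping.keys q"
  have "eval_at A (p + q) = (\<Sum>m\<in>?S. Poly_Mapping.lookup (p + q) m * eval_monom A m)"
    using keys_add[of p q] by (intro eval_at_superset) auto
  then show ?thesis
    by (simp add: eval_at_superset[of ?S] lookup_add distrib_right sum.distrib)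
qed

lemma eval_at_single: "eval_at A (Poly_Mapping.single m c) = c * eval_monom A m"
  by (subst eval_at_superset[of "{m}"]) auto

lemma poly_mapping_sum_singles:
  "p = (\<Sum>m\<in>Poly_Mapping.keys p. Poly_Mapping.single m (Poly_Mapping.lookup p m))"
  by (intro poly_mapping_eqI)
    (auto simp: lookup_sum lookup_single when_def in_keys_iff sum.delta' if_distrib cong: if_cong)

lemma eval_at_0 [simp]: "eval_at A 0 = 0"
  by (simp add: eval_at_def)

lemma eval_at_sum: "eval_at A (sum f S) = (\<Sum>s\<in>S. eval_at A (f s))"
  by (induction S rule: infinite_finite_induct) (auto simp: eval_at_add)

lemma eval_at_mult: "eval_at A (p * q) = eval_at A p * eval_at A q"
proof -
  let ?P = "Poly_Mapping.keys p" and ?Q = "Poly_Mapping.keys q"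
  let ?sp = "\<lambda>m. Poly_Mapping.single m (Poly_Mapping.lookup p m)"
  let ?sq = "\<lambda>m. Poly_Mapping.single m (Poly_Mapping.lookup q m)"
  have "eval_at A (p * q) = eval_at A (sum ?sp ?P * sum ?sq ?Q)"
    using poly_mapping_sum_singles[of p] poly_mapping_sum_singles[of q] by metis
  also have "\<dots> = (\<Sum>m\<in>?P. \<Sum>m'\<in>?Q. eval_at A (?sp m * ?sq m'))"
    by (simp add: sum_product eval_at_sum)
  also have "\<dots> = (\<Sum>m\<in>?P. \<Sum>m'\<in>?Q. eval_at A (?sp m) * eval_at A (?sq m'))"
    by (simp add: mult_single eval_at_single eval_monom_add mult_ac)
  also have "\<dots> = eval_at A (sum ?sp ?P) * eval_at A (sum ?sq ?Q)"
    by (simp add: sum_product eval_at_sum)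
  also have "\<dots> = eval_at A p * eval_at A q"
    using poly_mapping_sum_singles[of p] poly_mapping_sum_singles[of q] by metis
  finally show ?thesis .
qed

lemma eval_at_1 [simp]: "eval_at A 1 = 1"
  using eval_at_single[of A 0 1] by (simp add: eval_monom_def)

lemma eval_at_Indet [simp]: "eval_at A (Indet x) = A $$ x"
  by (simp add: Indet_def eval_at_single eval_monom_def)

text \<open>Gives \<open>eval_hom.hom_det\<close>: evaluation commutes with taking minors.\<close>

interpretation eval_hom: comm_ring_hom "eval_at A" for A
  by unfold_locales (simp_all add: eval_at_add eval_at_mult)

text \<open>Membership in \<open>poly_ring n\<close> confines the indeterminates to positions that
  \<open>entry_lim\<close> controls.\<close>

lemma eval_at_tendsto:
  assumes p: "p \<in> poly_ring n" and lim: "entry_lim n X A"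
  shows "(\<lambda>m. eval_at (X m) p) \<longlonglongrightarrow> eval_at A p"
  unfolding eval_at_def
proof (intro tendsto_sum tendsto_mult tendsto_const tendsto_prod tendsto_power)
  fix m x assume "m \<in> Poly_Mapping.keys p" "x \<in> Poly_Mapping.keys m"
  then have "x \<in> {(i, j). i \<le> j \<and> j < n}"
    using p by (auto simp: poly_ring_def)
  then show "(\<lambda>l. X l $$ x) \<longlonglongrightarrow> A $$ x"
    using lim by (auto simp: entry_lim_def)
qed

lemma poly_ring_add: "p \<in> poly_ring n \<Longrightarrow> q \<in> poly_ring n \<Longrightarrow> p + q \<in> poly_ring n"
  unfolding poly_ring_def using keys_add[of p q] by blast

lemma poly_ring_mult:
  assumes "p \<in> poly_ring n" "q \<in> poly_ring n"
  shows "p * q \<in> poly_ring n"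
  unfolding poly_ring_def
proof (intro CollectI ballI)
  fix m assume "m \<in> Poly_Mapping.keys (p * q)"
  then obtain a b where ab: "m = a + b" "a \<in> Poly_Mapping.keys p" "b \<in> Poly_Mapping.keys q"
    using keys_mult[of p q] by blast
  then show "Poly_Mapping.keys m \<subseteq> {(i, j). i \<le> j \<and> j < n}"
    using assms keys_add[of a b] unfolding poly_ring_def by blast
qed

lemma poly_ring_const: "0 \<in> poly_ring n" "1 \<in> poly_ring n" "- 1 \<in> poly_ring n"
  by (simp_all add: poly_ring_def)

lemma poly_ring_Indet: "i \<le> j \<Longrightarrow> j < n \<Longrightarrow> Indet (i, j) \<in> poly_ring n"
  by (simp add: poly_ring_def Indet_def)

lemma poly_ring_sum: "(\<And>s. s \<in> S \<Longrightarrow> f s \<in> poly_ring n) \<Longrightarrow> sum f S \<in> poly_ring n"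
  by (induction S rule: infinite_finite_induct) (auto simp: poly_ring_add poly_ring_const)

lemma poly_ring_prod: "(\<And>s. s \<in> S \<Longrightarrow> f s \<in> poly_ring n) \<Longrightarrow> prod f S \<in> poly_ring n"
  by (induction S rule: infinite_finite_induct) (auto simp: poly_ring_mult poly_ring_const)

lemma poly_ring_det:
  assumes "\<And>p q. p < r \<Longrightarrow> q < r \<Longrightarrow> F p q \<in> poly_ring n"
  shows "det (mat r r (\<lambda>(p, q). F p q)) \<in> poly_ring n"
proof -
  have "det (mat r r (\<lambda>(p, q). F p q)) = (\<Sum>s | s permutes {0..<r}. signof s * (\<Prod>i = 0..<r. F i (s i)))"
    by (subst det_def'[of _ r]) (auto intro!: sum.cong prod.cong simp: permutes_in_image)
  also have "\<dots> \<in> poly_ring n"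
  proof (intro poly_ring_sum poly_ring_mult poly_ring_prod)
    fix s assume s: "s \<in> {s. s permutes {0..<r}}"
    show "signof s \<in> poly_ring n"
      by (cases s rule: sign_cases) (simp_all add: poly_ring_const)
    show "F i (s i) \<in> poly_ring n" if "i \<in> {0..<r}" for i
      using s that permutes_in_image[of s "{0..<r}" i] by (intro assms) auto
  qed
  finally show ?thesis .
qed

section \<open>The rank conditions\<close>

definition generators :: "nat \<Rightarrow> (nat \<Rightarrow> nat) \<Rightarrow> mpoly mat \<Rightarrow> mpoly set" where
  "generators n w P = (\<Union>i\<in>{1..n}. \<Union>j\<in>{1..n}. minors (corner_rank n w i j + 1) (corner n P i j))"

lemma zero_in_ideal_gen: "0 \<in> ideal_gen n G"
  unfolding ideal_gen_def by (rule CollectI, rule exI[of _ "{}"]) auto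

lemma generator_in_ideal_gen:
  assumes "g \<in> G"
  shows "g \<in> ideal_gen n G"
  unfolding ideal_gen_def
  by (rule CollectI, rule exI[of _ "{g}"], rule exI[of _ "\<lambda>_. 1"]) (use assms in \<open>auto simp: poly_ring_const\<close>)

lemma set_sum_member:
  fixes S :: "'i \<Rightarrow> 'a :: comm_monoid_add set"
  assumes "finite I" "i \<in> I" "x \<in> S i" "\<And>l. l \<in> I \<Longrightarrow> 0 \<in> S l"
  shows "x \<in> sum S I"
proof -
  have "sum (\<lambda>l. if l = i then x else 0) I = x"
    using assms by simp
  then show ?thesis
    unfolding set_sum_alt[OF assms(1)] using assms
    by (intro CollectI exI[of _ "\<lambda>l. if l = i then x else 0"]) auto
qed

lemma zero_in_set_sum:
  fixes S :: "'i \<Rightarrow> 'a :: comm_monoid_add set"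
  assumes "finite I" "\<And>l. l \<in> I \<Longrightarrow> 0 \<in> S l"
  shows "0 \<in> sum S I"
  unfolding set_sum_alt[OF assms(1)] using assms by (intro CollectI exI[of _ "\<lambda>_. 0"]) auto

text \<open>A generator lies in the sum of ideals, with zero in all other summands; evaluation is
  additive and multiplicative, so zeros on generators spread to the sum.\<close>

lemma eval_rank_ideal_iff:
  "(\<forall>p \<in> rank_ideal n w P. eval_at A p = 0) \<longleftrightarrow> (\<forall>p \<in> generators n w P. eval_at A p = 0)"
proof
  assume L: "\<forall>p \<in> rank_ideal n w P. eval_at A p = 0"
  have "g \<in> rank_ideal n w P" if g: "g \<in> generators n w P" for g
  proof -
    obtain i j where ij: "i \<in> {1..n}" "j \<in> {1..n}" "g \<in> minors (corner_rank n w i j + 1) (corner n P i j)"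
      using g unfolding generators_def by blast
    show ?thesis
      unfolding rank_ideal_def
      by (intro set_sum_member[OF _ ij(1)] set_sum_member[OF _ ij(2)] generator_in_ideal_gen ij
          zero_in_set_sum zero_in_ideal_gen) auto
  qed
  with L show "\<forall>p \<in> generators n w P. eval_at A p = 0"
    by blast
next
  assume R: "\<forall>p \<in> generators n w P. eval_at A p = 0"
  have gen: "eval_at A p = 0"
    if "i \<in> {1..n}" "j \<in> {1..n}" and p: "p \<in> ideal_gen n (minors (corner_rank n w i j + 1) (corner n P i j))" for i j p
  proof -
    obtain F c where F: "p = (\<Sum>g\<in>F. c g * g)" "F \<subseteq> minors (corner_rank n w i j + 1) (corner n P i j)"
      using p unfolding ideal_gen_def by blast
    have "eval_at A g = 0" if "g \<in> F" for g
      using R F(2) that \<open>i \<in> {1..n}\<close> \<open>j \<in> {1..n}\<close> by (auto simp: generators_def)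
    then show ?thesis
      by (simp add: F(1) eval_at_sum eval_at_mult)
  qed
  show "\<forall>p \<in> rank_ideal n w P. eval_at A p = 0"
  proof
    fix p assume "p \<in> rank_ideal n w P"
    then obtain f where f: "p = sum f {1..n}"
      "\<And>i. i \<in> {1..n} \<Longrightarrow> f i \<in> (\<Sum>j = 1..n. ideal_gen n (minors (corner_rank n w i j + 1) (corner n P i j)))"
      by (auto simp: rank_ideal_def set_sum_alt)
    have "eval_at A (f i) = 0" if i: "i \<in> {1..n}" for i
    proof -
      obtain h where h: "f i = sum h {1..n}"
        "\<And>j. j \<in> {1..n} \<Longrightarrow> h j \<in> ideal_gen n (minors (corner_rank n w i j + 1) (corner n P i j))"
        using f(2)[OF i] by (auto simp: set_sum_alt)
      then show ?thesis
        using gen[OF i] by (simp add: eval_at_sum)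
    qed
    then show "eval_at A p = 0"
      by (simp add: f(1) eval_at_sum)
  qed
qed

lemma generators_in_poly_ring:
  assumes P: "P \<in> carrier_mat n n" and ent: "\<And>i j. i < n \<Longrightarrow> j < n \<Longrightarrow> P $$ (i, j) \<in> poly_ring n"
  shows "generators n w P \<subseteq> poly_ring n"
proof
  fix g assume "g \<in> generators n w P"
  then obtain i j where ij: "i \<in> {1..n}" "j \<in> {1..n}" and g: "g \<in> minors (corner_rank n w i j + 1) (corner n P i j)"
    unfolding generators_def by blast
  define r where "r = corner_rank n w i j + 1"
  have ij': "i \<le> n" "1 \<le> j" "j \<le> n"
    using ij by auto
  obtain I J where IJ: "g = det (mat r r (\<lambda>(p, q). P $$ (pick I p, pick J q + (j - 1))))"
    "I \<subseteq> {..<i}" "J \<subseteq> {..<n - (j - 1)}" "card I = r" "card J = r"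
    using g unfolding minors_corner[OF P ij'] r_def[symmetric] by blast
  show "g \<in> poly_ring n"
    unfolding IJ(1)
  proof (intro poly_ring_det ent)
    show "pick I p < n" if "p < r" for p
      using pick_in_set_le[of p I] that IJ(2,4) ij'(1) by auto
    show "pick J q + (j - 1) < n" if "q < r" for q
      using pick_in_set_le[of q J] that IJ(3,5) by auto
  qed
qed

text \<open>The zero-based column of the 1 in the zero-based row \<open>k\<close> of
  \<open>perm_mat n w\<close>.\<close>

definition perm_col :: "nat \<Rightarrow> (nat \<Rightarrow> nat) \<Rightarrow> nat \<Rightarrow> nat" where
  "perm_col n w k = n - w (k + 1)"

lemma perm_col_bij:
  assumes w: "w permutes {1..n}"
  shows "bij_betw (perm_col n w) {..<n} {..<n}"
proof -
  have 1: "bij_betw Suc {..<n} {1..n}"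
    by (auto simp: bij_betw_def lessThan_atLeast0 image_Suc_atLeastLessThan)
  have 2: "bij_betw w {1..n} {1..n}"
    using permutes_imp_bij[OF w] .
  have 3: "bij_betw (\<lambda>x. n - x) {1..n} {..<n}"
    by (rule bij_betwI[where g = "\<lambda>x. n - x"]) auto
  have "bij_betw ((\<lambda>x. n - x) \<circ> (w \<circ> Suc)) {..<n} {..<n}"
    using bij_betw_trans[OF bij_betw_trans[OF 1 2] 3] .
  then show ?thesis
    by (simp add: perm_col_def o_def cong: bij_betw_cong)
qed

lemma corner_rank_eq:
  assumes w: "w permutes {1..n}" and ij: "i \<in> {1..n}" "j \<in> {1..n}"
  shows "corner_rank n w i j = card {k. k < i \<and> j - 1 \<le> perm_col n w k}"
proof -
  have wk: "1 \<le> w k" "w k \<le> n" if "1 \<le> k" "k \<le> n" for k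
    using permutes_in_image[OF w, of k] that by auto
  have inner: "(\<Sum>l = j..n. perm_mat n w $$ (k - 1, l - 1)) = (if j - 1 \<le> perm_col n w (k - 1) then 1 else 0)"
    if k: "k \<in> {1..i}" for k
  proof -
    have "(\<Sum>l = j..n. perm_mat n w $$ (k - 1, l - 1)) = (\<Sum>l = j..n. if n + 1 - w k = l then 1 else 0)"
      using k ij by (intro sum.cong) (auto simp: perm_mat_def)
    also have "\<dots> = (if n + 1 - w k \<in> {j..n} then 1 else 0)"
      by simp
    also have "n + 1 - w k \<in> {j..n} \<longleftrightarrow> j - 1 \<le> perm_col n w (k - 1)"
      using wk[of k] k ij by (auto simp: perm_col_def)
    finally show ?thesis .
  qed
  have "corner_rank n w i j = (\<Sum>k = 1..i. if j - 1 \<le> perm_col n w (k - 1) then 1 else 0)"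
    unfolding corner_rank_def using inner by (intro sum.cong) auto
  also have "\<dots> = (\<Sum>k<i. if j - 1 \<le> perm_col n w k then 1 else 0)"
    by (rule sum.reindex_bij_witness[where i = Suc and j = "\<lambda>k. k - 1"]) auto
  also have "\<dots> = card ({..<i} \<inter> {k. j - 1 \<le> perm_col n w k})"
    by (simp add: sum.If_cases)
  also have "{..<i} \<inter> {k. j - 1 \<le> perm_col n w k} = {k. k < i \<and> j - 1 \<le> perm_col n w k}"
    by auto
  finally show ?thesis .
qed

text \<open>\<open>ev\<close> serves both generic matrices: \<open>Sigma_mat\<close> meets it at
  symmetric \<open>A\<close>, \<open>Y_mat\<close> at upper triangular \<open>A\<close>.\<close>

lemma generators_vanish_iff:
  assumes w: "w permutes {1..n}" and A: "A \<in> carrier_mat n n" and P: "P \<in> carrier_mat n n"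
    and ev: "\<And>i j. i < n \<Longrightarrow> j < n \<Longrightarrow> eval_at A (P $$ (i, j)) = A $$ (i, j)"
  shows "(\<forall>p \<in> generators n w P. eval_at A p = 0) \<longleftrightarrow> rank_bounded n (perm_col n w) A"
proof -
  have corner: "(\<forall>p \<in> minors r (corner n P i j). eval_at A p = 0) \<longleftrightarrow> (\<forall>d \<in> minors r (corner n A i j). d = 0)"
    if ij: "i \<le> n" "1 \<le> j" "j \<le> n" for r i j
  proof -
    have "eval_at A (det (mat r r (\<lambda>(p, q). P $$ (pick I p, pick J q + (j - 1)))))
        = det (mat r r (\<lambda>(p, q). A $$ (pick I p, pick J q + (j - 1))))"
      if IJ: "I \<subseteq> {..<i}" "J \<subseteq> {..<n - (j - 1)}" "card I = r" "card J = r" for I J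
    proof -
      have "pick I p < n" if "p < r" for p
        using pick_in_set_le[of p I] that IJ(1,3) ij(1) by auto
      moreover have "pick J q + (j - 1) < n" if "q < r" for q
        using pick_in_set_le[of q J] that IJ(2,4) by auto
      ultimately have "map_mat (eval_at A) (mat r r (\<lambda>(p, q). P $$ (pick I p, pick J q + (j - 1))))
          = mat r r (\<lambda>(p, q). A $$ (pick I p, pick J q + (j - 1)))"
        using ev by (intro eq_matI) auto
      then show ?thesis
        by (metis eval_hom.hom_det)
    qed
    then show ?thesis
      unfolding minors_corner[OF P ij] minors_corner[OF A ij] by (auto; metis)
  qed
  have "(\<forall>p \<in> generators n w P. eval_at A p = 0) \<longleftrightarrow>
      (\<forall>i\<in>{1..n}. \<forall>j\<in>{1..n}. \<forall>p \<in> minors (corner_rank n w i j + 1) (corner n P i j). eval_at A p = 0)"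
    by (auto simp: generators_def)
  also have "\<dots> \<longleftrightarrow> (\<forall>i\<in>{1..n}. \<forall>j\<in>{1..n}. \<forall>K \<subseteq> {j - 1..<n}.
      card K = card {k. k < i \<and> j - 1 \<le> perm_col n w k} + 1 \<longrightarrow> dependent_cols A i K)"
    by (intro ball_cong refl) (auto simp: corner minors_corner_zero_iff[OF A] corner_rank_eq[OF w])
  also have "\<dots> \<longleftrightarrow> rank_bounded n (perm_col n w) A"
    unfolding rank_bounded_def
  proof (intro iffI allI impI ballI)
    fix a b K assume *: "\<forall>i\<in>{1..n}. \<forall>j\<in>{1..n}. \<forall>K \<subseteq> {j - 1..<n}.
      card K = card {k. k < i \<and> j - 1 \<le> perm_col n w k} + 1 \<longrightarrow> dependent_cols A i K"
      "1 \<le> a \<and> a \<le> n \<and> b < n \<and> K \<subseteq> {b..<n} \<and> card K = card {k. k < a \<and> b \<le> perm_col n w k} + 1"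
    then show "dependent_cols A a K"
      using *(1)[rule_format, of a "Suc b" K] by auto
  next
    fix i j K assume *: "\<forall>a b K. 1 \<le> a \<and> a \<le> n \<and> b < n \<and> K \<subseteq> {b..<n} \<and>
      card K = card {k. k < a \<and> b \<le> perm_col n w k} + 1 \<longrightarrow> dependent_cols A a K"
      "i \<in> {1..n}" "j \<in> {1..n}" "K \<subseteq> {j - 1..<n}" "card K = card {k. k < i \<and> j - 1 \<le> perm_col n w k} + 1"
    then have "j - 1 < n"
      by auto
    with * show "dependent_cols A i K"
      using *(1)[rule_format, of i "j - 1" K] by simp
  qed
  finally show ?thesis .
qed

section \<open>The closure of the image\<close>

lemma Sigma_mat_carrier: "Sigma_mat n \<in> carrier_mat n n" and Y_mat_carrier: "Y_mat n \<in> carrier_mat n n"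
  by (simp_all add: Sigma_mat_def Y_mat_def)

lemma in_V_sym_iff:
  assumes "w permutes {1..n}"
  shows "A \<in> V_sym n w \<longleftrightarrow> A \<in> Sym n \<and> rank_bounded n (perm_col n w) A"
proof -
  have "eval_at A (Sigma_mat n $$ (i, j)) = A $$ (i, j)" if A: "A \<in> Sym n" and ij: "i < n" "j < n" for i j
  proof -
    have "A $$ (i, j) = A $$ (j, i)"
      using A ij unfolding Sym_def by (metis (mono_tags, lifting) carrier_matD index_transpose_mat(1) mem_Collect_eq)
    then show ?thesis
      using ij by (auto simp: Sigma_mat_def min_def max_def)
  qed
  then show ?thesis
    using generators_vanish_iff[OF assms _ Sigma_mat_carrier, of A]
    by (auto simp: V_sym_def vanishing_set_def J_sym_def eval_rank_ideal_iff Sym_def)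
qed

lemma in_V_up_iff:
  assumes "w permutes {1..n}"
  shows "A \<in> V_up n w \<longleftrightarrow> A \<in> Up n \<and> rank_bounded n (perm_col n w) A"
proof -
  have "eval_at A (Y_mat n $$ (i, j)) = A $$ (i, j)" if "A \<in> Up n" "i < n" "j < n" for i j
    using that by (auto simp: Up_def Y_mat_def)
  then show ?thesis
    using generators_vanish_iff[OF assms _ Y_mat_carrier, of A]
    by (auto simp: V_up_def vanishing_set_def J_up_def eval_rank_ideal_iff Up_def)
qed

text \<open>The minors serve as equations, since they visibly lie in
  \<open>poly_ring n\<close>.\<close>

lemma zariski_closed_V_sym: "zariski_closed n (V_sym n w)"
  unfolding zariski_closed_def
proof (intro exI conjI)
  show "generators n w (Sigma_mat n) \<subseteq> poly_ring n"
    by (intro generators_in_poly_ring Sigma_mat_carrier) (auto simp: Sigma_mat_def intro!: poly_ring_Indet)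
  show "V_sym n w = vanishing_set (Sym n) (generators n w (Sigma_mat n))"
    by (simp add: V_sym_def vanishing_set_def J_sym_def eval_rank_ideal_iff)
qed

text \<open>The same relation \<open>x\<close> serves for \<open>U\<close> and
  \<open>psi U\<close>.\<close>

lemma psi_rank_bounded:
  assumes U: "U \<in> Up n" and rk: "rank_bounded n c U"
  shows "rank_bounded n c (psi U)"
proof -
  have Uc: "U \<in> carrier_mat n n" and up: "\<And>i j. i < n \<Longrightarrow> j < i \<Longrightarrow> U $$ (i, j) = 0"
    using U by (auto simp: Up_def upper_triangular_def)
  have "dependent_cols (psi U) a K" if dep: "dependent_cols U a K" and K: "a \<le> n" "K \<subseteq> {..<n}" for a K
  proof -
    obtain x where x: "\<exists>j\<in>K. x j \<noteq> 0" "\<forall>i<a. (\<Sum>j\<in>K. U $$ (i, j) * x j) = 0"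
      using dep by (auto simp: dependent_cols_def)
    have "(\<Sum>j\<in>K. psi U $$ (i, j) * x j) = 0" if i: "i < a" for i
    proof -
      have "psi U $$ (i, j) = (\<Sum>l<n. U $$ (l, i) * U $$ (l, j))" if "j \<in> K" for j
        using that i K Uc unfolding psi_def by (subst mult_entry[where n = n]) auto
      then have "(\<Sum>j\<in>K. psi U $$ (i, j) * x j) = (\<Sum>j\<in>K. \<Sum>l<n. U $$ (l, i) * (U $$ (l, j) * x j))"
        by (intro sum.cong) (auto simp: sum_distrib_right mult.assoc)
      also have "\<dots> = (\<Sum>l<n. U $$ (l, i) * (\<Sum>j\<in>K. U $$ (l, j) * x j))"
        unfolding sum_distrib_left by (rule sum.swap)
      also have "\<dots> = 0"
      proof (intro sum.neutral ballI)
        fix l assume "l \<in> {..<n}"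
        then show "U $$ (l, i) * (\<Sum>j\<in>K. U $$ (l, j) * x j) = 0"
          using x(2) up[of l i] i by (cases "l < a") auto
      qed
      finally show ?thesis .
    qed
    then show ?thesis
      unfolding dependent_cols_def using x(1) by blast
  qed
  moreover have "K \<subseteq> {b..<n} \<Longrightarrow> K \<subseteq> {..<n}" for b :: nat and K
    by auto
  ultimately show ?thesis
    using rk unfolding rank_bounded_def by blast
qed

lemma symmetric_limit_of_psi:
  assumes c: "bij_betw c {..<n} {..<n}" and S: "S \<in> Sym n" and rk: "rank_bounded n c S"
  obtains U where "\<forall>\<^sub>F m in sequentially. U m \<in> Up n \<and> rank_bounded n c (U m)"
    "entry_lim n (\<lambda>m. psi (U m)) S"
proof -
  have Sc: "S \<in> carrier_mat n n" and Ssym: "transpose_mat S = S"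
    using S by (auto simp: Sym_def)
  obtain s B P Q where s: "bij_betw s {..<n} {..<n}"
    "\<And>a b. a \<le> n \<Longrightarrow> b \<le> n \<Longrightarrow> card {k. k < a \<and> b \<le> s k} \<le> card {k. k < a \<and> b \<le> c k}"
    and B: "lower_tri n B" and Pc: "P \<in> carrier_mat n n" and Q: "Q = mat n n (\<lambda>(l, j). B $$ (s l, j))"
    and PQ: "P * Q = 1\<^sub>m n" and QP: "Q * P = 1\<^sub>m n" and low: "lower_tri n (S * P)"
    using rank_bounded_factor[OF Sc c rk] by blast
  have Qc: "Q \<in> carrier_mat n n"
    by (simp add: Q)
  have "lagrangian n (S * P) P"
    unfolding lagrangian_def
  proof (intro conjI ballI impI)
    show "transpose_mat (S * P) * P = transpose_mat P * (S * P)"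
      using Sc Pc Ssym by (simp add: transpose_mult_sq[of _ n] mat_assoc[of _ n])
    fix x assume x: "x \<in> carrier_vec n" "(S * P) *\<^sub>v x = 0\<^sub>v n \<and> P *\<^sub>v x = 0\<^sub>v n"
    have "(Q * P) *\<^sub>v x = 0\<^sub>v n"
      using x Qc Pc by (simp add: assoc_mult_mat_vec[of _ n n _ n] mult_zero_vec[of _ n])
    then show "x = 0\<^sub>v n"
      unfolding QP using x(1) by simp
  qed (use Sc Pc in auto)
  then have "(S * P, P) \<in> seq_closure n (cholesky_pairs n)"
    using low by (rule lagrangian_lower_in_closure_cholesky)
  then obtain X Y where XY: "\<And>m. (X m, Y m) \<in> cholesky_pairs n" "entry_lim n X (S * P)" "entry_lim n Y P"
    by (rule seq_closureE) blast
  have "\<exists>W. inv_lower n (X m) \<and> inv_lower n W \<and> Y m = transpose_mat W * W * X m" for m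
    using XY(1)[of m] by (auto simp: cholesky_pairs_def)
  then obtain W where X: "\<And>m. inv_lower n (X m)" and W: "\<And>m. inv_lower n (W m)"
    and Y: "\<And>m. Y m = transpose_mat (W m) * W m * X m"
    by metis
  note Xc = inv_lowerD(1)[OF X] and Wc = inv_lowerD(1)[OF W]
  have Yc: "Y m \<in> carrier_mat n n" for m
    unfolding Y using Xc Wc by (simp add: mult_carrier_mat[of _ n n _ n])
  define M where "M m = X m * Q" for m
  define N where "N m = Y m * Q" for m
  have Mc: "M m \<in> carrier_mat n n" and Nc: "N m \<in> carrier_mat n n" for m
    using Xc Yc Qc by (simp_all add: M_def N_def mult_carrier_mat[of _ n n _ n])
  have "entry_lim n M (S * P * Q)"
    unfolding M_def using Xc Qc Sc Pc by (intro entry_lim_mult XY(2) entry_lim_const) auto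
  then have M: "entry_lim n M S"
    using Sc Pc Qc PQ by (simp add: mat_cancel_mid[of _ n])
  have "entry_lim n N (P * Q)"
    unfolding N_def using Yc Qc Pc by (intro entry_lim_mult XY(3) entry_lim_const) auto
  then have N: "entry_lim n N (1\<^sub>m n)"
    by (simp add: PQ)
  obtain T where T: "\<And>m. lower_tri n (T m)" "entry_lim n T (1\<^sub>m n)"
    "\<forall>\<^sub>F m in sequentially. \<forall>i<n. \<forall>j<i. (N m * T m) $$ (i, j) = 0"
    using triangularize_near_identity[OF N Nc] by blast
  note Tc = lower_triD(1)[OF T(1)]
  define U where "U m = W m * X m * Q * T m" for m
  have Uc: "U m \<in> carrier_mat n n" for m
    using Wc Xc Qc Tc by (simp add: U_def mult_carrier_mat[of _ n n _ n])
  \<comment> \<open>Once the right side is upper triangular, \<open>U^T W\<close> is lower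
    triangular, and cancelling \<open>W\<close> shows that \<open>U\<close> is upper
    triangular.\<close>
  have WU: "transpose_mat (W m) * U m = N m * T m" for m
  proof -
    have WX: "W m * X m \<in> carrier_mat n n" and WXQ: "W m * X m * Q \<in> carrier_mat n n"
      using Wc Xc Qc by (simp_all add: mult_carrier_mat[of _ n n _ n])
    have "transpose_mat (W m) * U m = transpose_mat (W m) * (W m * X m * Q) * T m"
      unfolding U_def using Wc WXQ Tc by (intro mat_assoc[symmetric]) auto
    also have "transpose_mat (W m) * (W m * X m * Q) = transpose_mat (W m) * (W m * X m) * Q"
      using Wc WX Qc by (intro mat_assoc[symmetric]) auto
    also have "transpose_mat (W m) * (W m * X m) = Y m"
      unfolding Y using Wc Xc by (intro mat_assoc[symmetric]) auto
    finally show ?thesis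
      by (simp add: N_def)
  qed
  have "\<forall>\<^sub>F m in sequentially. U m \<in> Up n \<and> rank_bounded n c (U m)"
    using T(3)
  proof eventually_elim
    case (elim m)
    have "lower_tri n (transpose_mat (U m) * W m)"
    proof -
      have NT: "N m * T m \<in> carrier_mat n n"
        using Nc Tc by (simp add: mult_carrier_mat[of _ n n _ n])
      have "transpose_mat (U m) * W m = transpose_mat (N m * T m)"
        unfolding WU[symmetric] using Wc Uc by (simp add: transpose_mult_sq[of _ n])
      then show ?thesis
        using elim NT by (auto simp: lower_tri_def carrier_matD[OF NT] simp del: index_mult_mat)
    qed
    then have "lower_tri n (transpose_mat (U m))"
      by (rule lower_tri_cancel_right[OF _ W, rotated]) (simp add: Uc)
    then have "U m \<in> Up n"
      using Uc[of m] by (auto simp: Up_def lower_tri_def upper_triangular_def)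
    moreover have "rank_bounded n c (U m)"
      unfolding U_def Q
      by (rule rank_bounded_lower_mult[OF s(2) _ B lower_tri_mult[OF inv_lowerD(2)[OF W] inv_lowerD(2)[OF X]] T(1)])
        (use s(1) in \<open>auto simp: bij_betw_def\<close>)
    ultimately show ?case
      by blast
  qed
  \<comment> \<open>\<open>W m\<close> is eliminated by \<open>WU\<close>. This is essential:
    \<open>X m\<close> may approach a singular matrix and nothing bounds \<open>W m\<close>, whereas
    all remaining factors converge.\<close>
  moreover have "psi (U m) = transpose_mat (T m) * (transpose_mat (M m) * N m) * T m" for m
  proof -
    have MT: "M m * T m \<in> carrier_mat n n"
      using Mc Tc by (simp add: mult_carrier_mat[of _ n n _ n])
    have "U m = W m * M m * T m"
      unfolding U_def M_def using mat_assoc[OF Wc Xc Qc, of m m] by simp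
    also have "\<dots> = W m * (M m * T m)"
      using Wc Mc Tc by (rule mat_assoc)
    finally have "transpose_mat (U m) = transpose_mat (M m * T m) * transpose_mat (W m)"
      using transpose_mult_sq[OF Wc MT] by simp
    then have "psi (U m) = transpose_mat (M m * T m) * (transpose_mat (W m) * U m)"
      unfolding psi_def using mat_assoc[of "transpose_mat (M m * T m)" n "transpose_mat (W m)" "U m"] MT Wc Uc
      by simp
    also have "\<dots> = transpose_mat (T m) * (transpose_mat (M m) * N m) * T m"
      unfolding WU using Mc[of m] Nc[of m] Tc[of m]
      by (simp add: transpose_mult_sq[of _ n] mat_assoc[of _ n] mult_carrier_mat[of _ n n _ n])
    finally show ?thesis .
  qed
  moreover have "entry_lim n (\<lambda>m. transpose_mat (T m) * (transpose_mat (M m) * N m) * T m)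
      (transpose_mat (1\<^sub>m n) * (transpose_mat S * 1\<^sub>m n) * 1\<^sub>m n)"
    using Tc Mc Nc Sc
    by (intro entry_lim_mult entry_lim_transpose T(2) M N) (simp_all add: mult_carrier_mat[of _ n n _ n])
  ultimately show thesis
    using that[of U] Sc Ssym by simp
qed

theorem proposition3p9:
  fixes n :: nat and w :: "nat \<Rightarrow> nat"
  assumes "w permutes {1..n}"
  shows "zariski_closed n hull (psi ` V_up n w) = V_sym n w"
proof
  have "psi U \<in> Sym n" if "U \<in> Up n" for U
    using that by (auto simp: Up_def Sym_def psi_def transpose_mult_sq[of _ n])
  then have "psi ` V_up n w \<subseteq> V_sym n w"
    using psi_rank_bounded by (auto simp: in_V_sym_iff[OF assms] in_V_up_iff[OF assms])
  then show "zariski_closed n hull (psi ` V_up n w) \<subseteq> V_sym n w"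
    using zariski_closed_V_sym by (rule hull_minimal)
next
  have "S \<in> Z" if S: "S \<in> V_sym n w" and Z: "zariski_closed n Z" "psi ` V_up n w \<subseteq> Z" for S Z
  proof -
    obtain F where F: "F \<subseteq> poly_ring n" "Z = vanishing_set (Sym n) F"
      using Z(1) by (auto simp: zariski_closed_def)
    have S': "S \<in> Sym n" "rank_bounded n (perm_col n w) S"
      using S by (simp_all add: in_V_sym_iff[OF assms])
    obtain U where U: "\<forall>\<^sub>F m in sequentially. U m \<in> Up n \<and> rank_bounded n (perm_col n w) (U m)"
      "entry_lim n (\<lambda>m. psi (U m)) S"
      by (rule symmetric_limit_of_psi[OF perm_col_bij[OF assms] S'])
    \<comment> \<open>The values of \<open>p\<close> at \<open>psi (U m)\<close> are eventually zero
      and also converge to the value at \<open>S\<close>.\<close>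
    have "eval_at S p = 0" if p: "p \<in> F" for p
    proof (rule tendsto_unique[OF sequentially_bot])
      show "(\<lambda>m. eval_at (psi (U m)) p) \<longlonglongrightarrow> eval_at S p"
        using p F(1) by (intro eval_at_tendsto[OF _ U(2)]) auto
      have "\<forall>\<^sub>F m in sequentially. eval_at (psi (U m)) p = 0"
        using U(1)
      proof eventually_elim
        case (elim m)
        then have "psi (U m) \<in> Z"
          using Z(2) by (auto simp: in_V_up_iff[OF assms])
        then show ?case
          using p F(2) by (simp add: vanishing_set_def)
      qed
      then show "(\<lambda>m. eval_at (psi (U m)) p) \<longlonglongrightarrow> 0"
        by (rule tendsto_eventually)
    qed
    then show "S \<in> Z"
      using F(2) S'(1) by (simp add: vanishing_set_def)
  qed
  then show "V_sym n w \<subseteq> zariski_closed n hull (psi ` V_up n w)"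
    by (auto simp: hull_def)
qed

end
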